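(* Let $n \geq 1$ and let $\mathbf{q} = (q_0, \dots, q_n)$ be positive integers with $\gcd(q_0, \dots, q_n) = 1$ and $\mathbf{q} \neq (1,1)$. Let $Z_{\widehat{\mathfrak{h}}}(\mathbb{WP}^n_{\mathbf{q}}(\mathbb{Q}),X)$ be the number of points $\mathfrak{p} \in \mathbb{WP}^n_{\mathbf{q}}(\mathbb{Q})$ of tautological height $\widehat{\mathfrak{h}}(\mathfrak{p}) \leq X$. Then $$Z_{\widehat{\mathfrak{h}}}(\mathbb{WP}^n_{\mathbf{q}}(\mathbb{Q}), X) = \frac{2^n}{\zeta(Q)} X^Q + O\left(X^{Q - \min_i q_i}\right),$$ where $Q = q_0 + \cdots + q_n$ and $\zeta$ is the Riemann zeta function.
   Context: Weighted projective space: $\mathbb{WP}^n_{\mathbf{q}}(\overline{\mathbb{Q}})$ is the set of nonzero tuples $\mathbf{x} = (x_0,\dots,x_n) \in \overline{\mathbb{Q}}^{n+1}$ modulo $\mathbf{x} \sim \lambda\star\mathbf{x} = (\lambda^{q_0}x_0, \dots, \lambda^{q_n}x_n)$, $\lambda \in \overline{\mathbb{Q}}^{\times}$; $\mathbb{WP}^n_{\mathbf{q}}(\mathbb{Q})$ is the subset of classes admitting a representative in $\mathbb{Q}^{n+1}$. Tautological height over $\mathbb{Q}$: for $\mathfrak{p} = [x_0:\cdots:x_n] \in \mathbb{WP}^n_{\mathbf{q}}(\mathbb{Q})$ with representative $\mathbf{x} \in \mathbb{Q}^{n+1}$, and for each prime $p$, put $\theta_p(\mathbf{x}) = \min_{x_i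 \ne 0} v_p(x_i)/q_i$, and $$\widehat{\mathfrak{h}}(\mathfrak{p}) = \prod_{p} p^{-\lfloor \theta_p(\mathbf{x}) \rfloor} \cdot \max_{0\le i\le n} |x_i|^{1/q_i}.$$ The expression on the right is unchanged under $\mathbf{x} \mapsto \lambda\star\mathbf{x}$ with $\lambda \in \mathbb{Q}^{\times}$, and it is treated as a function of the point $\mathfrak{p}$. If $\mathbf{x}\in\mathbb{Z}^{n+1}$ is a representative with weighted gcd equal to $1$ (no integer $d>1$ with $d^{q_i}\mid x_i$ for all $i$), then $\widehat{\mathfrak{h}}(\mathfrak{p}) = \max_i |x_i|^{1/q_i}$. *)

theory Defs
  imports "HOL-Analysis.Analysis" "HOL-Library.Landau_Symbols"
begin

section \<open>Weighted projective space\<close>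

text \<open>Algebraic closure of the rationals, realised inside the complex numbers.\<close>

definition Qbar :: "complex set" where
  "Qbar = {z. algebraic z}"

definition wps_tuples :: "nat \<Rightarrow> (nat \<Rightarrow> complex) set" where
  "wps_tuples n = {x \<in> {..n} \<rightarrow>\<^sub>E Qbar. \<exists>i\<le>n. x i \<noteq> 0}"

definition wstar :: "nat \<Rightarrow> (nat \<Rightarrow> nat) \<Rightarrow> complex \<Rightarrow> (nat \<Rightarrow> complex) \<Rightarrow> (nat \<Rightarrow> complex)" where
  "wstar n q c x = (\<lambda>i\<in>{..n}. c ^ q i * x i)"

definition wps_rel :: "nat \<Rightarrow> (nat \<Rightarrow> nat) \<Rightarrow> ((nat \<Rightarrow> complex) \<times> (nat \<Rightarrow> complex)) set" where
  "wps_rel n q =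
     {(x, y). x \<in> wps_tuples n \<and> y \<in> wps_tuples n \<and> (\<exists>c\<in>Qbar - {0}. y = wstar n q c x)}"

definition WP :: "nat \<Rightarrow> (nat \<Rightarrow> nat) \<Rightarrow> (nat \<Rightarrow> complex) set set" where
  "WP n q = wps_tuples n // wps_rel n q"

definition rat_rep :: "nat \<Rightarrow> (nat \<Rightarrow> complex) set \<Rightarrow> (nat \<Rightarrow> rat) \<Rightarrow> bool" where
  "rat_rep n P x \<longleftrightarrow> (\<lambda>i\<in>{..n}. of_rat (x i)) \<in> P"

definition WPQ :: "nat \<Rightarrow> (nat \<Rightarrow> nat) \<Rightarrow> (nat \<Rightarrow> complex) set set" where
  "WPQ n q = {P \<in> WP n q. \<exists>x. rat_rep n P x}"


section \<open>Tautological height\<close>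

text \<open>The \<open>p\<close>-adic valuation of a rational number; the value at \<open>0\<close> is never used.\<close>

definition rat_val :: "nat \<Rightarrow> rat \<Rightarrow> int" where
  "rat_val p r = int (multiplicity (int p) (fst (quotient_of r)))
               - int (multiplicity (int p) (snd (quotient_of r)))"

definition theta :: "nat \<Rightarrow> (nat \<Rightarrow> nat) \<Rightarrow> nat \<Rightarrow> (nat \<Rightarrow> rat) \<Rightarrow> real" where
  "theta n q p x = Min ((\<lambda>i. real_of_int (rat_val p (x i)) / real (q i)) ` {i. i \<le> n \<and> x i \<noteq> 0})"

text \<open>The product over all primes is written as the product over the primes with nonzero exponent;
  for a nonzero tuple these are finitely many, and every other factor is \<open>1\<close>.\<close>

definition height_formula :: "nat \<Rightarrow> (nat \<Rightarrow> nat) \<Rightarrow> (nat \<Rightarrow> rat) \<Rightarrow> real" where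
  "height_formula n q x =
     (\<Prod>p\<in>{p. prime p \<and> \<lfloor>theta n q p x\<rfloor> \<noteq> 0}. real p powi (- \<lfloor>theta n q p x\<rfloor>)) *
     Max ((\<lambda>i. \<bar>real_of_rat (x i)\<bar> powr (1 / real (q i))) ` {..n})"

text \<open>The formula is invariant under scaling by nonzero rationals, but a point is a class under
  scaling by algebraic numbers. If the weights of the nonzero coordinates have a common factor, the
  point has rational representatives that are not rational multiples of each other, and the formula
  can differ between them: for weights \<open>(1, 2)\<close> the tuples \<open>(0, 1)\<close> and \<open>(0, 2)\<close> represent the same
  point, with values \<open>1\<close> and \<open>sqrt 2\<close>. A tautological height is therefore any function on points
  whose value at each rational point is given by the formula at some rational representative. At
  points where the weights of the nonzero coordinates are coprime the value is determined
  uniquely.\<close>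

definition tautological_height ::
    "nat \<Rightarrow> (nat \<Rightarrow> nat) \<Rightarrow> ((nat \<Rightarrow> complex) set \<Rightarrow> real) \<Rightarrow> bool" where
  "tautological_height n q h \<longleftrightarrow>
     (\<forall>P\<in>WPQ n q. \<exists>x. rat_rep n P x \<and> h P = height_formula n q x)"

lemma tautological_height_exists: "\<exists>h. tautological_height n q h"
  unfolding tautological_height_def by (rule bchoice) (auto simp: WPQ_def)

definition Z_count ::
    "nat \<Rightarrow> (nat \<Rightarrow> nat) \<Rightarrow> ((nat \<Rightarrow> complex) set \<Rightarrow> real) \<Rightarrow> real \<Rightarrow> nat" where
  "Z_count n q h X = card {P \<in> WPQ n q. h P \<le> X}"


section \<open>Riemann zeta function\<close>

text \<open>Dirichlet series, which agrees with the zeta function for real \<open>s > 1\<close>.\<close>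

definition zeta :: "real \<Rightarrow> real" where
  "zeta s = (\<Sum>k. 1 / real (Suc k) powr s)"

end

theory Submission
  imports Defs "HOL-Computational_Algebra.Squarefree"
begin

text \<open>
  Multiplying a rational representative by the prime product in the height formula turns it into an
  integer tuple with weighted gcd \<open>1\<close>, and the height becomes \<open>max \<bar>y i\<bar> powr (1 / q i)\<close>. If all coordinates are
  nonzero, coprimality of the weights makes this tuple unique up to the action of \<open>-1\<close>, which is free
  because some weight is odd; so these points are half the primitive tuples without zero coordinates
  in the box \<open>\<bar>y i\<bar> \<le> X ^ q i\<close>. Points with a zero coordinate may have a height depending on the chosen
  representative, but each still yields a primitive integer tuple in the box with a zero coordinate,
  and there are only \<open>O(X ^ (Q - min q))\<close> of those.

  Moebius inversion over the weighted gcd writes the number of primitive tuples as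
  \<open>\<Sum>d. mobius d * N (X / d)\<close> with \<open>N Y = (\<Prod>i\<le>n. 2 * \<lfloor>Y ^ q i\<rfloor>)\<close>. The estimate
  \<open>N Y = 2 ^ (n + 1) * Y ^ Q + O(Y ^ (Q - min q))\<close> holds for all \<open>Y > 0\<close>, not just \<open>Y \<ge> 1\<close>, so it can be
  summed over all \<open>d\<close> at once; the error series converges because \<open>q \<noteq> (1, 1)\<close> gives \<open>Q - min q \<ge> 2\<close>.
\<close>

section \<open>Algebraic numbers and the scaling relation\<close>

text \<open>All monomials in \<open>a\<close> and \<open>b\<close> lie in the rational span of the
  finitely many \<open>a ^ i * b ^ j\<close> with \<open>i < m\<close> and \<open>j < l\<close>.
  Sufficiently many powers of \<open>a * b\<close> are therefore linearly dependent, and a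
  dependence is an annihilating polynomial.\<close>

lemma algebraic_mult:
  fixes a b :: "'a :: field_char_0"
  assumes "algebraic a" "algebraic b"
  shows "algebraic (a * b)"
proof -
  interpret V: vector_space "\<lambda>(r::rat) (z::'a). of_rat r * z"
    by unfold_locales (auto simp: algebra_simps of_rat_add of_rat_mult)
  have reduce: "\<exists>m. \<exists>r :: nat \<Rightarrow> rat. c ^ m = (\<Sum>i<m. of_rat (r i) * c ^ i)"
    if "algebraic c" for c :: 'a
  proof -
    obtain p where p: "\<And>i. coeff p i \<in> \<rat>" "p \<noteq> 0" "poly p c = 0"
      using \<open>algebraic c\<close> algebraic_altdef by blast
    define m where "m = degree p"
    have "\<forall>i. \<exists>r. - (coeff p i / lead_coeff p) = of_rat r"
      using p(1) by (metis Rats_divide Rats_minus_iff Rats_cases)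
    then obtain r where r: "\<And>i. - (coeff p i / lead_coeff p) = of_rat (r i)"
      by metis
    have "(\<Sum>i\<le>m. coeff p i * c ^ i) = 0"
      using p(3) by (simp add: poly_altdef m_def)
    then have "lead_coeff p * c ^ m = - (\<Sum>i<m. coeff p i * c ^ i)"
      by (simp add: m_def lessThan_Suc_atMost[symmetric] eq_neg_iff_add_eq_0 add.commute)
    then have "c ^ m = - (\<Sum>i<m. coeff p i * c ^ i) / lead_coeff p"
      using p(2) by (simp add: field_simps)
    also have "\<dots> = (\<Sum>i<m. - (coeff p i / lead_coeff p) * c ^ i)"
      by (simp add: sum_divide_distrib sum_negf)
    finally show ?thesis
      unfolding r by blast
  qed
  obtain m r where a: "a ^ m = (\<Sum>i<m. of_rat (r i) * a ^ i)"
    using reduce assms(1) by blast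
  obtain l s where b: "b ^ l = (\<Sum>i<l. of_rat (s i) * b ^ i)"
    using reduce assms(2) by blast
  define T where "T = (\<lambda>(i, j). a ^ i * b ^ j) ` ({..<m} \<times> {..<l})"
  have T: "finite T"
    by (simp add: T_def)
  have span: "a ^ i * b ^ j \<in> V.span T" for i j
  \<comment> \<open>Replacing \<open>a ^ m\<close> or \<open>b ^ l\<close> by lower powers strictly
    decreases the total degree, hence the measure \<open>i + j\<close>.\<close>
  proof (induction "i + j" arbitrary: i j rule: less_induct)
    case less
    consider "i < m" "j < l" | "i \<ge> m" | "j \<ge> l"
      by linarith
    then show ?case
    proof cases
      case 1
      then show ?thesis
        by (intro V.span_base) (auto simp: T_def)
    next
      case 2
      have "a ^ i * b ^ j = a ^ (i - m) * a ^ m * b ^ j"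
        using 2 by (simp flip: power_add)
      also have "\<dots> = (\<Sum>k<m. of_rat (r k) * (a ^ (i - m + k) * b ^ j))"
        unfolding a by (simp add: sum_distrib_left sum_distrib_right power_add mult_ac)
      also have "\<dots> \<in> V.span T"
        using 2 by (intro V.span_sum V.span_scale less) auto
      finally show ?thesis .
    next
      case 3
      have "a ^ i * b ^ j = a ^ i * (b ^ (j - l) * b ^ l)"
        using 3 by (simp flip: power_add)
      also have "\<dots> = (\<Sum>k<l. of_rat (s k) * (a ^ i * b ^ (j - l + k)))"
        unfolding b by (simp add: sum_distrib_left sum_distrib_right power_add mult_ac)
      also have "\<dots> \<in> V.span T"
        using 3 by (intro V.span_sum V.span_scale less) auto
      finally show ?thesis .
    qed
  qed
  define N where "N = card T"
  define f where "f = (\<lambda>k. (a * b) ^ k)"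
  show ?thesis
  \<comment> \<open>The dimension count needs \<open>N + 1\<close> distinct powers. If two powers
    coincide, the difference of the two monomials already annihilates \<open>a * b\<close>.\<close>
  proof (cases "inj_on f {..N}")
    case False
    then obtain j k where "f j = f k" "j \<noteq> k"
      by (auto simp: inj_on_def)
    then have "poly (monom 1 j - monom 1 k) (a * b) = 0" "monom 1 j - monom 1 k \<noteq> (0 :: 'a poly)"
      by (auto simp: f_def poly_monom dest: monom_eq_iff'[THEN iffD1])
    moreover have "coeff (monom 1 j - monom 1 k) i \<in> (\<rat> :: 'a set)" for i
      by simp
    ultimately show ?thesis
      by (intro algebraicI')
  next
    case True
    have "f ` {..N} \<subseteq> V.span T"
      using span by (auto simp: f_def power_mult_distrib)
    moreover have "card (f ` {..N}) > card T"
      using True by (simp add: card_image N_def)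
    ultimately have "V.dependent (f ` {..N})"
      using V.independent_span_bound[OF T] by fastforce
    then obtain u where u: "\<exists>v\<in>f ` {..N}. u v \<noteq> 0" "(\<Sum>v\<in>f ` {..N}. of_rat (u v) * v) = 0"
      by (subst (asm) V.dependent_finite) auto
    define p where "p = (\<Sum>k\<le>N. monom (of_rat (u (f k)) :: 'a) k)"
    have coeff: "coeff p i = (if i \<le> N then of_rat (u (f i)) else 0)" for i
      by (simp add: p_def coeff_sum)
    have "poly p (a * b) = (\<Sum>k\<le>N. of_rat (u (f k)) * f k)"
      by (simp add: p_def poly_sum poly_monom f_def)
    also have "\<dots> = 0"
      using u(2) by (simp add: sum.reindex[OF True])
    finally have "poly p (a * b) = 0" .
    moreover have "p \<noteq> 0"
      using u(1) coeff by (metis coeff_0 imageE atMost_iff of_rat_eq_0_iff)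
    moreover have "coeff p i \<in> \<rat>" for i
      by (simp add: coeff)
    ultimately show ?thesis
      by (intro algebraicI')
  qed
qed

lemma Qbar_mult: "c \<in> Qbar \<Longrightarrow> d \<in> Qbar \<Longrightarrow> c * d \<in> Qbar"
  by (simp add: Qbar_def algebraic_mult)

lemma Qbar_inverse: "c \<in> Qbar \<Longrightarrow> inverse c \<in> Qbar"
  by (auto simp: Qbar_def)

lemma Qbar_of_rat: "of_rat r \<in> Qbar"
proof -
  have "coeff [:- of_rat r, 1 :: complex:] i \<in> \<rat>" for i
    by (cases i) (auto simp: coeff_pCons split: nat.split)
  then show ?thesis
    unfolding Qbar_def by (auto intro!: algebraicI'[of "[:- of_rat r, 1:]"])
qed

lemma Qbar_of_int: "of_int k \<in> Qbar"
  using Qbar_of_rat[of "of_int k"] by simp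

lemma Qbar_1: "1 \<in> Qbar"
  using Qbar_of_int[of 1] by simp

lemma Qbar_power: "c \<in> Qbar \<Longrightarrow> c ^ k \<in> Qbar"
  by (induction k) (auto simp: Qbar_1 Qbar_mult)

lemma wstar_in_tuples:
  "c \<in> Qbar \<Longrightarrow> c \<noteq> 0 \<Longrightarrow> x \<in> wps_tuples n \<Longrightarrow> wstar n q c x \<in> wps_tuples n"
  by (auto simp: wps_tuples_def wstar_def intro!: Qbar_mult Qbar_power)

lemma wstar_wstar: "wstar n q c (wstar n q d x) = wstar n q (c * d) x"
  by (auto simp: wstar_def power_mult_distrib mult.assoc)

lemma wstar_1: "x \<in> wps_tuples n \<Longrightarrow> wstar n q 1 x = x"
  by (auto simp: wps_tuples_def wstar_def PiE_iff extensional_def)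

lemma wps_relI:
  "x \<in> wps_tuples n \<Longrightarrow> c \<in> Qbar \<Longrightarrow> c \<noteq> 0 \<Longrightarrow> (x, wstar n q c x) \<in> wps_rel n q"
  by (auto simp: wps_rel_def wstar_in_tuples)

lemma equiv_wps_rel: "equiv (wps_tuples n) (wps_rel n q)"
proof (rule equivI)
  show "wps_rel n q \<subseteq> wps_tuples n \<times> wps_tuples n"
    by (auto simp: wps_rel_def)
  show "refl_on (wps_tuples n) (wps_rel n q)"
    using wps_relI[of _ n 1 q] by (auto simp: refl_on_def wstar_1 Qbar_1)
  show "sym (wps_rel n q)"
  proof (rule symI)
    fix x y assume "(x, y) \<in> wps_rel n q"
    then obtain c where c: "x \<in> wps_tuples n" "c \<in> Qbar" "c \<noteq> 0" "y = wstar n q c x"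
      by (auto simp: wps_rel_def)
    then have "wstar n q (inverse c) y = x"
      by (simp add: wstar_wstar wstar_1)
    then show "(y, x) \<in> wps_rel n q"
      using wps_relI[of y n "inverse c" q] c by (auto simp: Qbar_inverse wstar_in_tuples)
  qed
  show "trans (wps_rel n q)"
  proof (rule transI)
    fix x y z assume "(x, y) \<in> wps_rel n q" "(y, z) \<in> wps_rel n q"
    then obtain c d where "x \<in> wps_tuples n" "c \<in> Qbar" "c \<noteq> 0" "y = wstar n q c x"
      "d \<in> Qbar" "d \<noteq> 0" "z = wstar n q d y"
      by (auto simp: wps_rel_def)
    then show "(x, z) \<in> wps_rel n q"
      using wps_relI[of x n "d * c" q] by (auto simp: wstar_wstar Qbar_mult)
  qed
qed

section \<open>Points represented by integer tuples\<close>

definition int_tuple :: "nat \<Rightarrow> (nat \<Rightarrow> int) \<Rightarrow> nat \<Rightarrow> complex" where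
  "int_tuple n y = (\<lambda>i\<in>{..n}. of_int (y i))"

definition int_point :: "nat \<Rightarrow> (nat \<Rightarrow> nat) \<Rightarrow> (nat \<Rightarrow> int) \<Rightarrow> (nat \<Rightarrow> complex) set" where
  "int_point n q y = wps_rel n q `` {int_tuple n y}"

lemma int_tuple_in_tuples: "i \<le> n \<Longrightarrow> y i \<noteq> 0 \<Longrightarrow> int_tuple n y \<in> wps_tuples n"
  by (auto simp: wps_tuples_def int_tuple_def Qbar_of_int)

lemma int_point_eqI:
  assumes "P \<in> WP n q" "int_tuple n y \<in> P"
  shows "int_point n q y = P"
  using assms equiv_wps_rel[of n q] unfolding WP_def int_point_def
  by (metis Image_singleton_iff equiv_class_eq quotientE)

lemma int_tuple_in_int_point:
  "i \<le> n \<Longrightarrow> y i \<noteq> 0 \<Longrightarrow> int_tuple n y \<in> int_point n q y"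
  unfolding int_point_def
  by (meson equiv_class_self equiv_wps_rel int_tuple_in_tuples)

lemma int_point_in_WPQ:
  assumes "i \<le> n" "y i \<noteq> 0"
  shows "int_point n q y \<in> WPQ n q"
proof -
  have "rat_rep n (int_point n q y) (\<lambda>i. of_int (y i))"
    using int_tuple_in_int_point[of i n y q] assms by (simp add: rat_rep_def int_tuple_def)
  then show ?thesis
    using int_tuple_in_tuples[of i n y] assms
    by (auto simp: WPQ_def WP_def int_point_def intro: quotientI)
qed

section \<open>Valuations of rational numbers\<close>

text \<open>Frees the valuation from the reduced fraction in its definition: comparing with the
  reduced form \<open>c / d\<close> gives \<open>a * d = c * b\<close>, and multiplicities of a
  prime add.\<close>

lemma rat_val_divide:
  assumes "prime p" "a \<noteq> 0" "b \<noteq> 0"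
  shows "rat_val p (of_int a / of_int b)
    = int (multiplicity (int p) a) - int (multiplicity (int p) b)"
proof -
  obtain c d where cd: "quotient_of (of_int a / of_int b) = (c, d)"
    by force
  have d: "d > 0" and eq: "(of_int a / of_int b :: rat) = of_int c / of_int d"
    using quotient_of_denom_pos[OF cd] quotient_of_div[OF cd] by auto
  have "(of_int (a * d) :: rat) = of_int (c * b)"
    using eq d assms by (simp add: field_simps)
  then have "a * d = c * b"
    by (simp only: of_int_eq_iff)
  moreover from this have "c \<noteq> 0"
    using d assms by auto
  ultimately have "multiplicity (int p) a + multiplicity (int p) d
    = multiplicity (int p) c + multiplicity (int p) b"
    using assms d prime_elem_multiplicity_mult_distrib[of "int p"] by (metis less_irrefl
        prime_elem_iff_prime_abs prime_imp_prime_elem prime_int_nat_transfer prime_nat_int_transfer)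
  then show ?thesis
    by (simp add: rat_val_def cd)
qed

lemma rat_val_of_int: "prime p \<Longrightarrow> a \<noteq> 0 \<Longrightarrow> rat_val p (of_int a) = int (multiplicity (int p) a)"
  using rat_val_divide[of p a 1] by simp

lemma rat_val_1: "rat_val p 1 = 0"
  by (simp add: rat_val_def)

lemma rat_val_mult:
  assumes "prime p" "r \<noteq> 0" "s \<noteq> 0"
  shows "rat_val p (r * s) = rat_val p r + rat_val p s"
proof -
  obtain a b where r: "quotient_of r = (a, b)" by force
  obtain c d where s: "quotient_of s = (c, d)" by force
  have b: "b > 0" and d: "d > 0" and eq: "r = of_int a / of_int b" "s = of_int c / of_int d"
    using quotient_of_denom_pos[OF r] quotient_of_div[OF r]
      quotient_of_denom_pos[OF s] quotient_of_div[OF s] by auto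
  then have "a \<noteq> 0" "c \<noteq> 0"
    using assms by auto
  moreover have "rat_val p (r * s) = rat_val p (of_int (a * c) / of_int (b * d))"
    by (simp add: eq)
  ultimately show ?thesis
    using b d assms(1) unfolding eq by (simp add: rat_val_divide prime_elem_multiplicity_mult_distrib
        del: of_int_mult)
qed

lemma rat_val_power: "prime p \<Longrightarrow> r \<noteq> 0 \<Longrightarrow> rat_val p (r ^ k) = int k * rat_val p r"
  by (induction k) (auto simp: rat_val_1 rat_val_mult algebra_simps)

lemma rat_val_inverse: "prime p \<Longrightarrow> r \<noteq> 0 \<Longrightarrow> rat_val p (inverse r) = - rat_val p r"
  using rat_val_mult[of p r "inverse r"] by (simp add: rat_val_1)

lemma rat_val_powi: "prime p \<Longrightarrow> r \<noteq> 0 \<Longrightarrow> rat_val p (r powi k) = k * rat_val p r"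
  by (auto simp: power_int_def rat_val_power rat_val_inverse)

lemma rat_val_prod:
  assumes "prime p" "\<And>i. i \<in> A \<Longrightarrow> f i \<noteq> 0"
  shows "rat_val p (\<Prod>i\<in>A. f i) = (\<Sum>i\<in>A. rat_val p (f i))"
  using assms(2)
  by (induction A rule: infinite_finite_induct) (auto simp: rat_val_1 rat_val_mult assms(1))

lemma rat_val_prime:
  assumes "prime p" "prime r"
  shows "rat_val p (of_nat r) = (if p = r then 1 else 0)"
proof -
  have "rat_val p (of_nat r) = int (multiplicity (int p) (int r))"
    using rat_val_of_int[of p "int r"] assms by auto
  then show ?thesis
    using assms by (auto simp: prime_multiplicity_other)
qed

text \<open>A prime dividing the reduced denominator does not divide the numerator, so the valuation
  there would be negative.\<close>

lemma rat_val_nonneg_imp_Ints: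
  assumes "r \<noteq> 0" "\<And>p. prime p \<Longrightarrow> rat_val p r \<ge> 0"
  shows "r \<in> \<int>"
proof -
  obtain a b where r: "quotient_of r = (a, b)" by force
  have b: "b > 0" and eq: "r = of_int a / of_int b" and cop: "coprime a b"
    using quotient_of_denom_pos[OF r] quotient_of_div[OF r] quotient_of_coprime[OF r] by auto
  have "b = 1"
  proof (rule ccontr)
    assume "b \<noteq> 1"
    then obtain p where p: "prime p" "p dvd nat b"
      using b prime_factor_nat[of "nat b"] by (metis nat_1 nat_eq_iff2 nat_one_as_int zero_neq_one less_le)
    then have "int p dvd b"
      using b dvd_nat_abs_iff[of p b] by simp
    then have "\<not> int p dvd a"
      using cop p by (metis not_coprimeI not_prime_unit prime_nat_int_transfer)
    then have "rat_val p r < 0"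
      using \<open>int p dvd b\<close> b p
      by (auto simp: rat_val_def r not_dvd_imp_multiplicity_0 prime_multiplicity_gt_zero_iff)
    with assms(2)[OF p(1)] show False
      by simp
  qed
  with eq show ?thesis
    by simp
qed

lemma finite_rat_val_nonzero:
  assumes "r \<noteq> 0"
  shows "finite {p. prime p \<and> rat_val p r \<noteq> 0}"
proof -
  obtain a b where r: "quotient_of r = (a, b)" by force
  have b: "b > 0" and eq: "r = of_int a / of_int b"
    using quotient_of_denom_pos[OF r] quotient_of_div[OF r] by auto
  then have "a \<noteq> 0"
    using assms by auto
  have "{p. prime p \<and> rat_val p r \<noteq> 0} \<subseteq> {p. p dvd nat \<bar>a\<bar>} \<union> {p. p dvd nat \<bar>b\<bar>}"
    unfolding dvd_nat_abs_iff rat_val_def r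
    by (auto intro: ccontr simp: not_dvd_imp_multiplicity_0)
  moreover have "finite \<dots>"
    using \<open>a \<noteq> 0\<close> b by (simp del: dvd_nat_abs_iff)
  ultimately show ?thesis
    by (rule finite_subset)
qed

section \<open>Primitive integer representatives\<close>

definition primitive :: "nat \<Rightarrow> (nat \<Rightarrow> nat) \<Rightarrow> (nat \<Rightarrow> int) \<Rightarrow> bool" where
  "primitive n q y \<longleftrightarrow> (\<forall>d::nat. (\<forall>i\<le>n. int d ^ q i dvd y i) \<longrightarrow> d = 1)"

lemma primitive_nonzero:
  assumes "primitive n q y"
  shows "\<exists>i\<le>n. y i \<noteq> 0"
proof (rule ccontr)
  assume "\<not> (\<exists>i\<le>n. y i \<noteq> 0)"
  then have "\<forall>i\<le>n. int 0 ^ q i dvd y i"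
    by auto
  with assms show False
    unfolding primitive_def by (metis zero_neq_one)
qed

lemma of_rat_power_int:
  "(of_rat (r powi k) :: 'a :: field_char_0) = of_rat r powi k"
  by (auto simp: power_int_def of_rat_power of_rat_inverse)

text \<open>At a prime where every nonzero coordinate has valuation 0 the minimum is 0, and each
  nonzero coordinate has only finitely many other primes.\<close>

lemma finite_theta_nonzero:
  assumes "\<exists>i\<le>n. x i \<noteq> 0"
  shows "finite {p. prime p \<and> \<lfloor>theta n q p x\<rfloor> \<noteq> 0}"
proof -
  define S where "S = {i. i \<le> n \<and> x i \<noteq> 0}"
  have S: "finite S" "S \<noteq> {}"
    using assms by (auto simp: S_def)
  have "{p. prime p \<and> \<lfloor>theta n q p x\<rfloor> \<noteq> 0} \<subseteq> (\<Union>i\<in>S. {p. prime p \<and> rat_val p (x i) \<noteq> 0})"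
  proof (rule ccontr)
    assume "\<not> ?thesis"
    then obtain p where p: "\<lfloor>theta n q p x\<rfloor> \<noteq> 0" "\<forall>i\<in>S. rat_val p (x i) = 0"
      by auto
    then have "(\<lambda>i. real_of_int (rat_val p (x i)) / real (q i)) ` S = {0}"
      using S by auto
    then have "theta n q p x = 0"
      by (simp add: theta_def S_def[symmetric])
    with p show False
      by simp
  qed
  then show ?thesis
    by (rule finite_subset) (use S in \<open>auto simp: S_def intro: finite_rat_val_nonzero\<close>)
qed

text \<open>Together the two inequalities characterize the floor as the largest integer
  \<open>e\<close> with \<open>q i * e\<close> at most the valuation of each nonzero
  \<open>x i\<close>; the second is witnessed by a coordinate attaining the minimum. After
  rescaling, the first gives integrality and the second primitivity.\<close>

lemma floor_theta:
  assumes "\<exists>i\<le>n. x i \<noteq> 0" "\<And>i. i \<le> n \<Longrightarrow> q i > 0"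
  shows "\<And>i. i \<le> n \<Longrightarrow> x i \<noteq> 0 \<Longrightarrow> int (q i) * \<lfloor>theta n q p x\<rfloor> \<le> rat_val p (x i)"
    and "\<exists>i\<le>n. x i \<noteq> 0 \<and> rat_val p (x i) < int (q i) * (\<lfloor>theta n q p x\<rfloor> + 1)"
proof -
  define S where "S = {i. i \<le> n \<and> x i \<noteq> 0}"
  have S: "finite S" "S \<noteq> {}"
    using assms by (auto simp: S_def)
  have th: "theta n q p x = Min ((\<lambda>i. real_of_int (rat_val p (x i)) / real (q i)) ` S)"
    by (simp add: theta_def S_def)
  show "int (q i) * \<lfloor>theta n q p x\<rfloor> \<le> rat_val p (x i)" if "i \<le> n" "x i \<noteq> 0" for i
  proof -
    have "theta n q p x \<le> real_of_int (rat_val p (x i)) / real (q i)"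
      unfolding th by (rule Min_le) (use that S in \<open>auto simp: S_def\<close>)
    then have "real_of_int \<lfloor>theta n q p x\<rfloor> \<le> real_of_int (rat_val p (x i)) / real (q i)"
      by linarith
    then have "real_of_int (int (q i) * \<lfloor>theta n q p x\<rfloor>) \<le> real_of_int (rat_val p (x i))"
      using assms(2)[OF that(1)] by (simp add: field_simps)
    then show ?thesis
      by (simp only: of_int_le_iff)
  qed
  have "theta n q p x \<in> (\<lambda>i. real_of_int (rat_val p (x i)) / real (q i)) ` S"
    unfolding th by (rule Min_in) (use S in auto)
  then obtain i where i: "i \<le> n" "x i \<noteq> 0" "theta n q p x = real_of_int (rat_val p (x i)) / real (q i)"
    by (auto simp: S_def)
  have "real_of_int (rat_val p (x i)) / real (q i) < real_of_int \<lfloor>theta n q p x\<rfloor> + 1"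
    unfolding i(3)[symmetric] by linarith
  then have "real_of_int (rat_val p (x i)) < real_of_int (int (q i) * (\<lfloor>theta n q p x\<rfloor> + 1))"
    using assms(2)[OF i(1)] by (simp add: field_simps)
  then have "rat_val p (x i) < int (q i) * (\<lfloor>theta n q p x\<rfloor> + 1)"
    by (simp only: of_int_less_iff)
  with i show "\<exists>i\<le>n. x i \<noteq> 0 \<and> rat_val p (x i) < int (q i) * (\<lfloor>theta n q p x\<rfloor> + 1)"
    by blast
qed

text \<open>Scaling by the prime product in the height formula clears all denominators and all common
  weighted factors at once.\<close>

lemma height_formula_normalize:
  assumes nz: "\<exists>i\<le>n. x i \<noteq> 0" and q: "\<And>i. i \<le> n \<Longrightarrow> q i > 0"
  obtains c y where "c > 0" "y \<in> {..n} \<rightarrow>\<^sub>E UNIV" "\<And>i. i \<le> n \<Longrightarrow> of_int (y i) = c ^ q i * x i"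
    "primitive n q y"
    "height_formula n q x = Max ((\<lambda>i. real_of_int \<bar>y i\<bar> powr (1 / real (q i))) ` {..n})"
proof -
  define e where "e p = \<lfloor>theta n q p x\<rfloor>" for p
  define F where "F = {p. prime p \<and> e p \<noteq> 0}"
  have F: "finite F"
    unfolding F_def e_def by (rule finite_theta_nonzero[OF nz])
  define c :: rat where "c = (\<Prod>p\<in>F. of_nat p powi (- e p))"
  have F0: "of_nat r powi (- e r) \<noteq> (0::rat)" if "r \<in> F" for r
    using that by (auto simp: F_def prime_gt_0_nat)
  have c0: "c > 0"
    unfolding c_def by (intro prod_pos zero_less_power_int) (auto simp: F_def intro: prime_gt_0_nat)
  \<comment> \<open>Only the factor at \<open>p\<close> contributes; for \<open>p\<close> outside
    \<open>F\<close> the exponent \<open>e p\<close> is 0, so the formula holds there too.\<close>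
  have val_c: "rat_val p c = - e p" if "prime p" for p
  proof -
    have "rat_val p c = (\<Sum>r\<in>F. rat_val p (of_nat r powi (- e r)))"
      unfolding c_def by (rule rat_val_prod) (use that F0 in auto)
    also have "\<dots> = (\<Sum>r\<in>F. if r = p then - e p else 0)"
      using that by (intro sum.cong) (auto simp: F_def rat_val_powi rat_val_prime)
    also have "\<dots> = - e p"
      using F that by (auto simp: F_def)
    finally show ?thesis .
  qed
  have e_le: "int (q i) * e p \<le> rat_val p (x i)" if "i \<le> n" "x i \<noteq> 0" for p i
    unfolding e_def by (rule floor_theta(1)[OF nz]) (use q that in auto)
  have e_gt: "\<exists>i\<le>n. x i \<noteq> 0 \<and> rat_val p (x i) < int (q i) * (e p + 1)" for p
    unfolding e_def by (rule floor_theta(2)[OF nz]) (use q in auto)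
  have val: "rat_val p (c ^ q i * x i) = rat_val p (x i) - int (q i) * e p"
    if "prime p" "x i \<noteq> 0" for p i
    using that c0 by (simp add: rat_val_mult rat_val_power val_c)
  have "c ^ q i * x i \<in> \<int>" if "i \<le> n" for i
  proof (cases "x i = 0")
    case False
    with c0 that show ?thesis
      using e_le[OF that False] by (intro rat_val_nonneg_imp_Ints) (auto simp: val)
  qed auto
  then have "\<forall>i\<in>{..n}. \<exists>k. of_int k = c ^ q i * x i"
    by (metis Ints_cases atMost_iff)
  then obtain y' where y': "\<forall>i\<in>{..n}. of_int (y' i) = c ^ q i * x i"
    by (rule bchoice[elim_format]) blast
  define y where "y = restrict y' {..n}"
  have y: "of_int (y i) = c ^ q i * x i" if "i \<le> n" for i
    using y' that by (simp add: y_def)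
  have prim: "primitive n q y"
    unfolding primitive_def
  proof (intro allI impI, rule ccontr)
    fix d :: nat assume d: "\<forall>i\<le>n. int d ^ q i dvd y i" and "d \<noteq> 1"
    \<comment> \<open>A prime common weighted factor would raise the valuation of every nonzero
      \<open>x i\<close> to at least \<open>q i * (e p + 1)\<close>, against the choice of
      \<open>e p\<close>.\<close>
    then obtain p where p: "prime p" "p dvd d"
      using prime_factor_nat by blast
    obtain i where i: "i \<le> n" "x i \<noteq> 0" "rat_val p (x i) < int (q i) * (e p + 1)"
      using e_gt[of p] by auto
    have yi: "y i \<noteq> 0"
      using y[OF i(1)] i(2) c0 by auto
    have "int p ^ q i dvd y i"
      using d i(1) p(2) by (meson dvd_power_same dvd_trans int_dvd_int_iff)
    then have "q i \<le> multiplicity (int p) (y i)"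
      using yi p(1) by (intro multiplicity_geI) auto
    also have "int (multiplicity (int p) (y i)) = rat_val p (x i) - int (q i) * e p"
      using rat_val_of_int[of p "y i"] yi p(1) val[of p i] i y by simp
    finally have "int (q i) * (e p + 1) \<le> rat_val p (x i)"
      by (simp add: algebra_simps)
    with i show False
      by simp
  qed
  have rc: "of_rat c = (\<Prod>p\<in>F. real p powi (- e p))"
    by (simp add: c_def of_rat_prod of_rat_power_int)
  have rc0: "real_of_rat c > 0"
    using c0 by simp
  \<comment> \<open>The prime product of the height equals the positive scalar \<open>c\<close>. It
    moves inside the maximum by monotonicity, and inside the root it becomes
    \<open>c ^ q i\<close>.\<close>
  have "mono (\<lambda>t. real_of_rat c * t)"
    using rc0 by (auto intro!: monoI mult_left_mono)
  then have "height_formula n q x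
    = Max ((\<lambda>t. real_of_rat c * t) ` (\<lambda>i. \<bar>real_of_rat (x i)\<bar> powr (1 / real (q i))) ` {..n})"
    unfolding height_formula_def F_def[symmetric] e_def[symmetric] rc[symmetric]
    by (intro mono_Max_commute) auto
  also have "(\<lambda>t. real_of_rat c * t) ` (\<lambda>i. \<bar>real_of_rat (x i)\<bar> powr (1 / real (q i))) ` {..n}
    = (\<lambda>i. real_of_int \<bar>y i\<bar> powr (1 / real (q i))) ` {..n}"
    unfolding image_image
  proof (rule image_cong)
    fix i assume "i \<in> {..n}"
    then have i: "i \<le> n" by simp
    have "real_of_int \<bar>y i\<bar> = \<bar>of_rat (of_int (y i))\<bar>"
      by simp
    also have "\<dots> = real_of_rat c ^ q i * \<bar>real_of_rat (x i)\<bar>"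
      using rc0 unfolding y[OF i] by (simp add: of_rat_mult of_rat_power abs_mult)
    finally have "real_of_int \<bar>y i\<bar> powr (1 / real (q i))
      = (real_of_rat c ^ q i) powr (1 / real (q i)) * \<bar>real_of_rat (x i)\<bar> powr (1 / real (q i))"
      using rc0 by (simp add: powr_mult)
    also have "(real_of_rat c ^ q i) powr (1 / real (q i)) = real_of_rat c"
      using rc0 q[OF i] by (simp flip: powr_realpow add: powr_powr)
    finally show "real_of_rat c * \<bar>real_of_rat (x i)\<bar> powr (1 / real (q i))
      = real_of_int \<bar>y i\<bar> powr (1 / real (q i))"
      by simp
  qed simp
  finally show ?thesis
    using that[of c y] c0 y prim by (auto simp: y_def)
qed

section \<open>Uniqueness of primitive representatives up to the action of -1\<close>

text \<open>The least positive exponent \<open>m\<close> with \<open>c ^ m\<close> rational divides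
  every other such exponent, by division with remainder. It thus divides every element of
  \<open>K\<close>, hence their gcd 1.\<close>

lemma Rats_of_coprime_powers:
  fixes c :: complex
  assumes "c \<noteq> 0" "\<And>k. k \<in> K \<Longrightarrow> c ^ k \<in> \<rat>" "Gcd K = (1::nat)"
  shows "c \<in> \<rat>"
proof -
  \<comment> \<open>The gcd of an empty set or of zeros alone is 0, so some positive exponent exists
    and \<open>LEAST\<close> is meaningful.\<close>
  obtain k where k: "k \<in> K" "k > 0"
    using assms(3) by (metis Gcd_0_iff gr0I subsetI singleton_iff zero_neq_one)
  define m where "m = (LEAST k. k > 0 \<and> c ^ k \<in> \<rat>)"
  have m: "m > 0" "c ^ m \<in> \<rat>"
    using LeastI[of "\<lambda>k. k > 0 \<and> c ^ k \<in> \<rat>" k] k assms(2) by (auto simp: m_def)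
  have "m dvd k" if "k \<in> K" for k
  proof (rule ccontr)
    assume "\<not> m dvd k"
    then have "k mod m > 0"
      by (simp add: mod_greater_zero_iff_not_dvd)
    have "c ^ k = c ^ (m * (k div m) + k mod m)"
      by simp
    also have "\<dots> = (c ^ m) ^ (k div m) * c ^ (k mod m)"
      by (simp only: power_add power_mult)
    finally have "c ^ (k mod m) = c ^ k / (c ^ m) ^ (k div m)"
      using assms(1) by simp
    then have "c ^ (k mod m) \<in> \<rat>"
      using assms(2)[OF that] m(2) by simp
    then have "m \<le> k mod m"
      unfolding m_def using \<open>k mod m > 0\<close> unfolding m_def by (intro Least_le) auto
    then show False
      using m(1) by (metis mod_less_divisor not_less)
  qed
  then have "m dvd 1"
    using assms(3) by (metis Gcd_greatest)
  with m show ?thesis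
    by simp
qed

text \<open>Since no \<open>y i\<close> vanishes, every \<open>c ^ q i\<close> is a quotient of
  integers, and coprime weights force \<open>c\<close> itself to be rational. Its reduced
  denominator is a common weighted factor of \<open>y\<close> and its numerator one of
  \<open>z\<close>, so both are units.\<close>

lemma primitive_related:
  assumes "primitive n q y" "primitive n q z" "\<And>i. i \<le> n \<Longrightarrow> y i \<noteq> 0"
    and "Gcd (q ` {..n}) = 1" "c \<noteq> 0" "int_tuple n z = wstar n q c (int_tuple n y)"
  shows "c = 1 \<or> c = -1"
proof -
  have zy: "of_int (z i) = c ^ q i * of_int (y i)" if "i \<le> n" for i
    using fun_cong[OF assms(6), of i] that by (simp add: int_tuple_def wstar_def)
  have "c ^ q i \<in> \<rat>" if "i \<le> n" for i
  proof -
    have "c ^ q i = of_int (z i) / of_int (y i)"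
      using zy[OF that] assms(3)[OF that] by simp
    then show ?thesis
      by simp
  qed
  then have "c \<in> \<rat>"
    using Rats_of_coprime_powers[of c "q ` {..n}"] assms by auto
  then obtain r where r: "c = of_rat r"
    by (elim Rats_cases)
  obtain a b where ab: "quotient_of r = (a, b)"
    by force
  have b: "b > 0" and eq: "r = of_int a / of_int b" and cop: "coprime a b"
    using quotient_of_denom_pos[OF ab] quotient_of_div[OF ab] quotient_of_coprime[OF ab] by auto
  have c: "c = of_int a / of_int b"
    by (simp add: r eq of_rat_divide)
  have ident: "z i * b ^ q i = a ^ q i * y i" if "i \<le> n" for i
  proof -
    have "(of_int (z i * b ^ q i) :: complex) = of_int (a ^ q i * y i)"
      using zy[OF that] b by (simp add: c field_simps)
    then show ?thesis
      by (simp only: of_int_eq_iff)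
  qed
  have "int (nat b) ^ q i dvd y i" if "i \<le> n" for i
  proof -
    have "b ^ q i dvd a ^ q i * y i"
      unfolding ident[OF that, symmetric] by simp
    then show ?thesis
      using cop b by (simp add: coprime_dvd_mult_right_iff coprime_commute)
  qed
  then have "nat b = 1"
    using assms(1) by (auto simp: primitive_def)
  then have "b = 1"
    by simp
  have "int (nat \<bar>a\<bar>) ^ q i dvd z i" if "i \<le> n" for i
    using ident[OF that] \<open>b = 1\<close> by (simp flip: power_abs)
  then have "nat \<bar>a\<bar> = 1"
    using assms(2) by (auto simp: primitive_def)
  then have "a = 1 \<or> a = -1"
    by linarith
  with c \<open>b = 1\<close> show ?thesis
    by auto
qed

section \<open>Boxes of integer tuples and points of bounded height\<close>

definition int_box :: "nat \<Rightarrow> (nat \<Rightarrow> nat) \<Rightarrow> real \<Rightarrow> (nat \<Rightarrow> int) set" where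
  "int_box n q X = (\<Pi>\<^sub>E i\<in>{..n}. {k. real_of_int \<bar>k\<bar> \<le> X ^ q i})"

definition prim_box :: "nat \<Rightarrow> (nat \<Rightarrow> nat) \<Rightarrow> real \<Rightarrow> (nat \<Rightarrow> int) set" where
  "prim_box n q X = {y \<in> int_box n q X. (\<forall>i\<le>n. y i \<noteq> 0) \<and> primitive n q y}"

text \<open>All such tuples are taken, primitive or not: their number bounds from above the number
  of points with a zero coordinate that are counted.\<close>

definition zero_box :: "nat \<Rightarrow> (nat \<Rightarrow> nat) \<Rightarrow> real \<Rightarrow> (nat \<Rightarrow> int) set" where
  "zero_box n q X = {y \<in> int_box n q X. \<exists>i\<le>n. y i = 0}"

lemma abs_int_le_iff: "real_of_int \<bar>k\<bar> \<le> x \<longleftrightarrow> k \<in> {- \<lfloor>x\<rfloor>..\<lfloor>x\<rfloor>}"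
proof -
  have "real_of_int \<bar>k\<bar> \<le> x \<longleftrightarrow> \<bar>k\<bar> \<le> \<lfloor>x\<rfloor>"
    by (simp only: le_floor_iff)
  then show ?thesis
    by (auto simp: abs_le_iff)
qed

lemma finite_int_box: "finite (int_box n q X)"
  unfolding int_box_def abs_int_le_iff by (intro finite_PiE) auto

text \<open>Translates a height bound into membership in a box, raising to the power
  \<open>q i\<close> being increasing and inverse to the root.\<close>

lemma Max_powr_le_iff:
  fixes a :: "nat \<Rightarrow> real"
  assumes "X > 0" "\<And>i. i \<le> n \<Longrightarrow> q i > 0" "\<And>i. i \<le> n \<Longrightarrow> a i \<ge> 0"
  shows "Max ((\<lambda>i. a i powr (1 / real (q i))) ` {..n}) \<le> X \<longleftrightarrow> (\<forall>i\<le>n. a i \<le> X ^ q i)"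
proof -
  have "a i powr (1 / real (q i)) \<le> X \<longleftrightarrow> a i \<le> X ^ q i" if "i \<le> n" for i
  proof
    assume "a i powr (1 / real (q i)) \<le> X"
    then have "(a i powr (1 / real (q i))) powr real (q i) \<le> X powr real (q i)"
      by (intro powr_mono2) auto
    then show "a i \<le> X ^ q i"
      using assms(1) assms(2,3)[OF that] by (simp add: powr_powr powr_realpow)
  next
    assume "a i \<le> X ^ q i"
    then have "a i powr (1 / real (q i)) \<le> (X powr real (q i)) powr (1 / real (q i))"
      using assms(1) assms(2,3)[OF that] by (intro powr_mono2) (auto simp: powr_realpow)
    then show "a i powr (1 / real (q i)) \<le> X"
      using assms(1) assms(2)[OF that] by (simp add: powr_powr)
  qed
  then show ?thesis
    by (subst Max_le_iff) auto
qed

text \<open>Whichever representative \<open>h\<close> uses at \<open>P\<close>, normalizing it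
  multiplies by a rational scalar and so stays in the class \<open>P\<close>. The resulting
  primitive tuple both represents \<open>P\<close> and computes \<open>h P\<close>.\<close>

lemma rational_point_normalize:
  assumes "tautological_height n q h" "P \<in> WPQ n q" "\<And>i. i \<le> n \<Longrightarrow> q i > 0"
  obtains y where "y \<in> {..n} \<rightarrow>\<^sub>E UNIV" "primitive n q y" "int_point n q y = P"
    "h P = Max ((\<lambda>i. real_of_int \<bar>y i\<bar> powr (1 / real (q i))) ` {..n})"
proof -
  obtain x where x: "rat_rep n P x" "h P = height_formula n q x"
    using assms(1,2) by (auto simp: tautological_height_def)
  define x' where "x' = (\<lambda>i\<in>{..n}. of_rat (x i) :: complex)"
  have P: "P \<in> WP n q" and x'P: "x' \<in> P"
    using assms(2) x(1) by (auto simp: WPQ_def rat_rep_def x'_def)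
  have x't: "x' \<in> wps_tuples n"
    using P x'P equiv_wps_rel[of n q] unfolding WP_def by (meson in_quotient_imp_subset subsetD)
  then have nz: "\<exists>i\<le>n. x i \<noteq> 0"
    by (auto simp: wps_tuples_def x'_def)
  obtain c y where c: "c > 0" and y: "y \<in> {..n} \<rightarrow>\<^sub>E UNIV"
    "\<And>i. i \<le> n \<Longrightarrow> of_int (y i) = c ^ q i * x i" "primitive n q y"
    "height_formula n q x = Max ((\<lambda>i. real_of_int \<bar>y i\<bar> powr (1 / real (q i))) ` {..n})"
    using assms(3) by (rule height_formula_normalize[of n x q, OF nz]) blast+
  have "(of_int (y i) :: complex) = of_rat c ^ q i * of_rat (x i)" if "i \<le> n" for i
  proof -
    have "(of_int (y i) :: complex) = of_rat (of_int (y i))"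
      by simp
    then show ?thesis
      unfolding y(2)[OF that] by (simp add: of_rat_mult of_rat_power)
  qed
  then have "int_tuple n y = wstar n q (of_rat c) x'"
    by (auto simp: int_tuple_def wstar_def x'_def)
  then have "(x', int_tuple n y) \<in> wps_rel n q"
    using wps_relI[OF x't, of "of_rat c" q] c by (simp add: Qbar_of_rat)
  then have "int_tuple n y \<in> P"
    using P x'P equiv_wps_rel[of n q] unfolding WP_def by (meson in_quotient_imp_closed)
  then have "int_point n q y = P"
    by (rule int_point_eqI[OF P])
  with y x(2) that show ?thesis
    by simp
qed

lemma int_point_eq_iff:
  assumes "i \<le> n" "y i \<noteq> 0" "j \<le> n" "z j \<noteq> 0"
  shows "int_point n q y = int_point n q z \<longleftrightarrow>
    (\<exists>c\<in>Qbar - {0}. int_tuple n z = wstar n q c (int_tuple n y))"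
proof -
  have t: "int_tuple n y \<in> wps_tuples n" "int_tuple n z \<in> wps_tuples n"
    using assms int_tuple_in_tuples by blast+
  then have "int_point n q y = int_point n q z \<longleftrightarrow> (int_tuple n y, int_tuple n z) \<in> wps_rel n q"
    unfolding int_point_def by (simp add: eq_equiv_class_iff[OF equiv_wps_rel])
  with t show ?thesis
    by (auto simp: wps_rel_def)
qed

text \<open>By \<open>primitive_related\<close> only the scalars 1 and -1 can connect the tuples.
  Nothing is assumed about the size of \<open>z\<close>, so that it may be the tuple produced by
  normalization, whose bound is then inferred from \<open>y\<close>.\<close>

lemma int_point_eq_iff_sign:
  assumes "y \<in> prim_box n q X" "z \<in> {..n} \<rightarrow>\<^sub>E UNIV" "primitive n q z" "Gcd (q ` {..n}) = 1"
  shows "int_point n q y = int_point n q z \<longleftrightarrow> z = y \<or> z = (\<lambda>i\<in>{..n}. (-1) ^ q i * y i)"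
proof -
  have y: "primitive n q y" "\<And>i. i \<le> n \<Longrightarrow> y i \<noteq> 0" "y \<in> extensional {..n}"
    using assms(1) by (auto simp: prim_box_def int_box_def PiE_iff)
  obtain j where j: "j \<le> n" "z j \<noteq> 0"
    using primitive_nonzero[OF assms(3)] by blast
  have iff: "int_point n q y = int_point n q z \<longleftrightarrow>
    (\<exists>c\<in>Qbar - {0}. int_tuple n z = wstar n q c (int_tuple n y))"
    using int_point_eq_iff[of 0 n y j z q] y j by blast
  have eq: "int_tuple n z = wstar n q (of_int s) (int_tuple n y) \<longleftrightarrow> z = (\<lambda>i\<in>{..n}. s ^ q i * y i)" for s
  proof
    assume *: "int_tuple n z = wstar n q (of_int s) (int_tuple n y)"
    have "z i = s ^ q i * y i" if "i \<le> n" for i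
    proof -
      have "(of_int (z i) :: complex) = of_int (s ^ q i * y i)"
        using fun_cong[OF *, of i] that by (simp add: int_tuple_def wstar_def)
      then show ?thesis
        by (simp only: of_int_eq_iff)
    qed
    then show "z = (\<lambda>i\<in>{..n}. s ^ q i * y i)"
      using assms(2) by (auto simp: PiE_iff extensional_def)
  qed (auto simp: int_tuple_def wstar_def)
  have "(\<exists>c\<in>Qbar - {0}. int_tuple n z = wstar n q c (int_tuple n y)) \<longleftrightarrow>
    int_tuple n z = wstar n q (of_int 1) (int_tuple n y) \<or>
    int_tuple n z = wstar n q (of_int (-1)) (int_tuple n y)"
    using primitive_related[OF y(1) assms(3) y(2) assms(4)] Qbar_of_int[of 1] Qbar_of_int[of "-1"]
    by fastforce
  then show ?thesis
    unfolding iff eq using y(3) by (auto simp: extensional_def)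
qed

text \<open>Each fiber of \<open>int_point\<close> on the box consists of a tuple \<open>y\<close>
  and its image \<open>y'\<close> under the action of -1.\<close>

lemma card_prim_box:
  assumes gcd: "Gcd (q ` {..n}) = 1"
  shows "card (prim_box n q X) = 2 * card (int_point n q ` prim_box n q X)"
proof -
  have fin: "finite (prim_box n q X)"
    using finite_int_box by (auto simp: prim_box_def)
  have fiber: "card {z \<in> prim_box n q X. int_point n q z = P} = 2"
    if P: "P \<in> int_point n q ` prim_box n q X" for P
  proof -
    from P obtain y where y: "y \<in> prim_box n q X" "P = int_point n q y"
      by auto
    define y' where "y' = (\<lambda>i\<in>{..n}. (-1) ^ q i * y i)"
    have "(int d ^ q i dvd (-1) ^ q i * y i) \<longleftrightarrow> int d ^ q i dvd y i" for d i
      by (cases "even (q i)") auto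
    then have y': "y' \<in> prim_box n q X"
      using y(1) by (auto simp: y'_def prim_box_def int_box_def primitive_def abs_mult power_abs)
    have "P = int_point n q z \<longleftrightarrow> z = y \<or> z = y'" if "z \<in> prim_box n q X" for z
      unfolding y(2) y'_def
      by (rule int_point_eq_iff_sign[OF y(1) _ _ gcd]) (use that in \<open>auto simp: prim_box_def int_box_def\<close>)
    then have "{z \<in> prim_box n q X. int_point n q z = P} = {y, y'}"
      using y(1) y' by auto
    \<comment> \<open>Weights with gcd 1 are not all even, and at an odd weight the nonzero
      coordinate changes sign.\<close>
    moreover have "y' \<noteq> y"
    proof
      assume *: "y' = y"
      have "2 dvd q i" if "i \<le> n" for i
      proof (rule ccontr)
        assume "\<not> 2 dvd q i"
        then have "y i = 0"
          using fun_cong[OF *, of i] that by (simp add: y'_def)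
        with y that show False
          by (auto simp: prim_box_def)
      qed
      then have "2 dvd Gcd (q ` {..n})"
        by (intro Gcd_greatest) auto
      with gcd show False
        by simp
    qed
    ultimately show ?thesis
      by simp
  qed
  have "card (prim_box n q X)
    = (\<Sum>P\<in>int_point n q ` prim_box n q X. card {z \<in> prim_box n q X. int_point n q z = P})"
    using sum.image_gen[OF fin, of "\<lambda>_. 1::nat"] by simp
  also have "\<dots> = 2 * card (int_point n q ` prim_box n q X)"
    by (simp add: fiber)
  finally show ?thesis .
qed

text \<open>Points from \<open>prim_box\<close> are always counted, and every other counted point
  comes from \<open>zero_box\<close>. The factor 2 is the size of the fibers in
  \<open>card_prim_box\<close>.\<close>

lemma Z_count_bounds:
  assumes q: "\<And>i. i \<le> n \<Longrightarrow> q i > 0" and gcd: "Gcd (q ` {..n}) = 1"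
    and h: "tautological_height n q h" and X: "X > 0"
  shows "card (prim_box n q X) \<le> 2 * Z_count n q h X"
    and "2 * Z_count n q h X \<le> card (prim_box n q X) + 2 * card (zero_box n q X)"
proof -
  define Z where "Z = {P \<in> WPQ n q. h P \<le> X}"
  have fin: "finite (prim_box n q X)" "finite (zero_box n q X)"
    using finite_int_box by (auto simp: prim_box_def zero_box_def)
  have in_box: "y \<in> int_box n q X \<longleftrightarrow>
      Max ((\<lambda>i. real_of_int \<bar>y i\<bar> powr (1 / real (q i))) ` {..n}) \<le> X"
    if "y \<in> {..n} \<rightarrow>\<^sub>E UNIV" for y
    using that by (subst Max_powr_le_iff[OF X q]) (auto simp: int_box_def PiE_iff)
  have "int_point n q ` prim_box n q X \<subseteq> Z"
  proof (rule image_subsetI)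
    fix y assume y: "y \<in> prim_box n q X"
    then have P: "int_point n q y \<in> WPQ n q"
      by (intro int_point_in_WPQ[of 0]) (auto simp: prim_box_def)
    \<comment> \<open>The value of \<open>h\<close> may stem from a representative other than
      \<open>y\<close>, but its normalization \<open>z\<close> agrees with \<open>y\<close> up to
      signs and so lies in the same box.\<close>
    obtain z where z: "z \<in> {..n} \<rightarrow>\<^sub>E UNIV" "primitive n q z" "int_point n q z = int_point n q y"
      "h (int_point n q y) = Max ((\<lambda>i. real_of_int \<bar>z i\<bar> powr (1 / real (q i))) ` {..n})"
      using rational_point_normalize[OF h P q] by blast
    have "z = y \<or> z = (\<lambda>i\<in>{..n}. (-1) ^ q i * y i)"
      using int_point_eq_iff_sign[OF y z(1,2) gcd] z(3) by simp
    then have "z \<in> int_box n q X"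
      using y by (auto simp: prim_box_def int_box_def abs_mult power_abs)
    with P z show "int_point n q y \<in> Z"
      by (simp add: Z_def in_box)
  qed
  moreover have "Z \<subseteq> int_point n q ` prim_box n q X \<union> int_point n q ` zero_box n q X"
  proof
    fix P assume "P \<in> Z"
    then have P: "P \<in> WPQ n q" "h P \<le> X"
      by (auto simp: Z_def)
    obtain y where y: "y \<in> {..n} \<rightarrow>\<^sub>E UNIV" "primitive n q y" "int_point n q y = P"
      "h P = Max ((\<lambda>i. real_of_int \<bar>y i\<bar> powr (1 / real (q i))) ` {..n})"
      using rational_point_normalize[OF h P(1) q] by blast
    then have "y \<in> int_box n q X"
      using P in_box by simp
    then have "y \<in> prim_box n q X \<union> zero_box n q X"
      using y(2) by (auto simp: prim_box_def zero_box_def)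
    with y(3) show "P \<in> int_point n q ` prim_box n q X \<union> int_point n q ` zero_box n q X"
      by blast
  qed
  ultimately have "card (int_point n q ` prim_box n q X) \<le> card Z"
    "card Z \<le> card (int_point n q ` prim_box n q X) + card (int_point n q ` zero_box n q X)"
    using fin by (auto intro!: card_mono order_trans[OF card_mono card_Un_le] dest: finite_subset)
  moreover have "card (int_point n q ` zero_box n q X) \<le> card (zero_box n q X)"
    by (rule card_image_le) (rule fin)
  ultimately show "card (prim_box n q X) \<le> 2 * Z_count n q h X"
    "2 * Z_count n q h X \<le> card (prim_box n q X) + 2 * card (zero_box n q X)"
    using card_prim_box[OF gcd, of X] by (auto simp: Z_count_def Z_def[symmetric])
qed

section \<open>The Moebius function and zeta\<close>

definition mobius :: "nat \<Rightarrow> real" where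
  "mobius d = (if squarefree d then (-1) ^ card (prime_factors d) else 0)"

lemma abs_mobius_le: "\<bar>mobius d\<bar> \<le> 1"
  by (simp add: mobius_def power_abs)

lemma mobius_prime_mult:
  assumes "prime p" "\<not> p dvd d" "squarefree d"
  shows "squarefree (p * d)" "mobius (p * d) = - mobius d"
proof -
  have "coprime p d"
    using assms by (simp add: prime_imp_coprime)
  then show sf: "squarefree (p * d)"
    using assms by (intro squarefree_mult_coprime squarefree_prime[OF assms(1)])
  have "d \<noteq> 0" "p \<noteq> 0"
    using assms by (auto intro!: Nat.gr0I)
  then have "prime_factors (p * d) = insert p (prime_factors d)"
    using assms(1) by (simp add: prime_factors_product prime_prime_factors)
  moreover have "p \<notin> prime_factors d"
    using assms(2) by (auto dest: in_prime_factors_imp_dvd)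
  ultimately show "mobius (p * d) = - mobius d"
    using sf assms(3) by (simp add: mobius_def)
qed

text \<open>For a prime \<open>p\<close> dividing \<open>n\<close>, multiplication by
  \<open>p\<close> maps the squarefree divisors prime to \<open>p\<close> onto those divisible by
  \<open>p\<close> and flips the sign of \<open>mobius\<close>, so the terms cancel in
  pairs.\<close>

lemma sum_mobius_divisors:
  assumes "n > 0"
  shows "(\<Sum>d | d dvd n. mobius d) = (if n = 1 then 1 else 0)"
proof (cases "n = 1")
  case True
  then show ?thesis
    by (simp add: mobius_def)
next
  case False
  then obtain p where p: "prime p" "p dvd n"
    using prime_factor_nat by blast
  define A where "A = {d. d dvd n \<and> squarefree d \<and> \<not> p dvd d}"
  define B where "B = {d. d dvd n \<and> squarefree d \<and> p dvd d}"
  have fin: "finite A" "finite B"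
    using assms by (auto simp: A_def B_def)
  have p0: "p \<noteq> 0"
    using p by auto
  have inj: "inj_on ((*) p) A"
    using p0 by (auto simp: inj_on_def)
  have "(*) p ` A = B"
  proof safe
    fix d assume d: "d \<in> A"
    then have "coprime p d"
      using p by (simp add: A_def prime_imp_coprime)
    with d show "p * d \<in> B"
      using p mobius_prime_mult(1)[OF p(1)] by (auto simp: A_def B_def divides_mult)
  next
    fix d assume d: "d \<in> B"
    then obtain e where e: "d = p * e"
      by (auto simp: B_def)
    have "\<not> p dvd e"
    proof
      assume "p dvd e"
      then have "p\<^sup>2 dvd d"
        by (simp add: e power2_eq_square)
      then have "is_unit p"
        using d squarefreeD[of d p] by (auto simp: B_def)
      with p show False
        by auto
    qed
    with d e show "d \<in> (*) p ` A"
      by (auto simp: A_def B_def dest: squarefree_multD intro: dvd_mult_right)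
  qed
  then have "(\<Sum>d\<in>B. mobius d) = (\<Sum>d\<in>A. mobius (p * d))"
    using inj by (metis (no_types, lifting) sum.reindex_cong)
  also have "\<dots> = - (\<Sum>d\<in>A. mobius d)"
    unfolding sum_negf[symmetric]
    by (rule sum.cong) (use mobius_prime_mult(2)[OF p(1)] in \<open>auto simp: A_def\<close>)
  finally have "(\<Sum>d\<in>A. mobius d) + (\<Sum>d\<in>B. mobius d) = 0"
    by simp
  moreover have "(\<Sum>d | d dvd n. mobius d) = (\<Sum>d\<in>A \<union> B. mobius d)"
    using assms by (intro sum.mono_neutral_right) (auto simp: A_def B_def mobius_def)
  moreover have "(\<Sum>d\<in>A \<union> B. mobius d) = (\<Sum>d\<in>A. mobius d) + (\<Sum>d\<in>B. mobius d)"
    using fin by (intro sum.union_disjoint) (auto simp: A_def B_def)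
  ultimately show ?thesis
    using False by simp
qed

section \<open>The Dirichlet series of the Moebius function\<close>

lemma zeta_has_sum:
  assumes "s \<ge> 2"
  shows "((\<lambda>k. 1 / real k ^ s) has_sum zeta (real s)) {0<..}"
proof -
  have "summable (\<lambda>k. inverse (real (Suc k) ^ s))"
    using inverse_power_summable[OF assms, where 'a = real] by (subst summable_Suc_iff) simp
  then have sm: "summable (\<lambda>k. 1 / real (Suc k) ^ s)"
    by (simp add: inverse_eq_divide)
  have "zeta (real s) = (\<Sum>k. 1 / real (Suc k) ^ s)"
    unfolding zeta_def by (subst powr_realpow) auto
  then have "(\<lambda>k. 1 / real (Suc k) ^ s) sums zeta (real s)"
    using sm by (simp add: summable_sums)
  then have "((\<lambda>k. 1 / real (Suc k) ^ s) has_sum zeta (real s)) UNIV"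
    using sm by (intro norm_summable_imp_has_sum) auto
  moreover have "bij_betw Suc UNIV {0<..}"
    by (auto simp: bij_betw_def image_def) (metis gr0_implies_Suc)
  ultimately show ?thesis
    using has_sum_reindex_bij_betw[of Suc UNIV "{0<..}" "\<lambda>k. 1 / real k ^ s"] by simp
qed

lemma mobius_summable:
  assumes "s \<ge> 2"
  shows "(\<lambda>d. norm (mobius d / real d ^ s)) summable_on {0<..}"
proof (rule Infinite_Sum.abs_summable_on_comparison_test)
  show "(\<lambda>k. norm (1 / real k ^ s)) summable_on {0<..}"
    using zeta_has_sum[OF assms] by (auto simp: summable_on_def)
  show "norm (mobius d / real d ^ s) \<le> norm (1 / real d ^ s)" for d
    using abs_mobius_le[of d] by (simp add: divide_right_mono)
qed

text \<open>The double series of \<open>mobius d / (k * d) ^ s\<close> is evaluated twice: as the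
  product of \<open>zeta\<close> with the wanted sum \<open>G\<close>, and grouped by
  \<open>m = k * d\<close>, where the divisor sums leave only \<open>m = 1\<close>.\<close>

lemma mobius_has_sum:
  assumes s: "s \<ge> 2"
  shows "((\<lambda>d. mobius d / real d ^ s) has_sum (1 / zeta (real s))) {0<..}"
proof -
  define P where "P = {0::nat<..}"
  define G where "G = infsum (\<lambda>d. mobius d / real d ^ s) P"
  define f where "f = (\<lambda>(k, d). 1 / real k ^ s * (mobius d / real d ^ s))"
  have G: "((\<lambda>d. mobius d / real d ^ s) has_sum G) P"
    unfolding G_def P_def
    by (intro has_sum_infsum Infinite_Sum.abs_summable_summable[OF mobius_summable[OF s]])
  have Z: "((\<lambda>k. 1 / real k ^ s) has_sum zeta (real s)) P"
    using zeta_has_sum[OF s] by (simp add: P_def)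
  \<comment> \<open>Absolute summability over pairs justifies the regrouping; the inner sums of
    norms are a constant multiple of \<open>1 / k ^ s\<close>.\<close>
  have "(\<lambda>x. norm (f x)) summable_on P \<times> P"
    unfolding Infinite_Sum.abs_summable_on_Sigma_iff
  proof (intro conjI ballI)
    fix k
    show "(\<lambda>d. norm (f (k, d))) summable_on P"
      using mobius_summable[OF s] unfolding f_def P_def prod.case norm_mult
      by (intro summable_on_cmult_right)
  next
    define c where "c = infsum (\<lambda>d. norm (mobius d / real d ^ s)) P"
    have "infsum (\<lambda>d. norm (f (k, d))) P = 1 / real k ^ s * c" for k
      unfolding f_def c_def using mobius_summable[OF s]
      by (simp only: prod.case norm_mult, subst infsum_cmult_right) (auto simp: P_def)
    moreover have "(\<lambda>k. 1 / real k ^ s * c) summable_on P"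
      using Z by (intro summable_on_cmult_left) (auto simp: summable_on_def)
    moreover have "c \<ge> 0"
      unfolding c_def by (rule infsum_nonneg) auto
    ultimately show "(\<lambda>k. norm (infsum (\<lambda>d. norm (f (k, d))) P)) summable_on P"
      by (simp add: abs_mult)
  qed
  then have "f summable_on P \<times> P"
    by (rule Infinite_Sum.abs_summable_summable)
  moreover have "((\<lambda>d. f (k, d)) has_sum 1 / real k ^ s * G) P" for k
    unfolding f_def prod.case by (rule has_sum_cmult_right[OF G])
  moreover have "((\<lambda>k. 1 / real k ^ s * G) has_sum zeta (real s) * G) P"
    by (rule has_sum_cmult_left[OF Z])
  ultimately have "(f has_sum zeta (real s) * G) (P \<times> P)"
    by (intro has_sum_SigmaI) auto
  also have "?this \<longleftrightarrow>
    ((\<lambda>(m, d). mobius d / real m ^ s) has_sum zeta (real s) * G) (SIGMA m:P. {d. d dvd m})"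
    by (rule has_sum_reindex_bij_witness[of _ "\<lambda>(m, d). (m div d, d)" "\<lambda>(k, d). (k * d, d)"])
      (auto simp: P_def f_def power_mult_distrib dvd_def mult.commute)
  finally have "((\<lambda>m. \<Sum>d | d dvd m. mobius d / real m ^ s) has_sum zeta (real s) * G) P"
    by (rule has_sum_SigmaD) (auto simp: P_def intro!: has_sum_finiteI)
  moreover have "(\<Sum>d | d dvd m. mobius d / real m ^ s) = (if m = 1 then 1 else 0)" if "m \<in> P" for m
    using sum_mobius_divisors[of m] that by (simp add: P_def flip: sum_divide_distrib)
  ultimately have "((\<lambda>m. if m = 1 then 1 else 0) has_sum zeta (real s) * G) P"
    by (simp cong: has_sum_cong)
  moreover have "((\<lambda>m. if m = 1 then 1 else 0) has_sum (1::real)) P"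
    by (rule has_sum_finite_neutralI[of "{1}"]) (auto simp: P_def)
  ultimately have "zeta (real s) * G = 1"
    by (rule has_sum_unique)
  \<comment> \<open>The product being 1 also shows that \<open>zeta\<close> does not vanish
    here.\<close>
  then have "G = 1 / zeta (real s)"
    by (metis mult_zero_left nonzero_mult_div_cancel_left zero_neq_one)
  with G show ?thesis
    by (simp add: P_def)
qed

section \<open>Counting lattice points\<close>

text \<open>Both sides agree after multiplication by \<open>gcd a b ^ k\<close>, because gcds
  commute with powers and lcm times gcd is the product.\<close>

lemma lcm_exp_nat: "lcm a b ^ k = lcm (a ^ k) (b ^ k)" for a b :: nat
proof (cases "a = 0 \<or> b = 0")
  case True
  then show ?thesis
    by (cases k) auto
next
  case False
  have "lcm a b ^ k * gcd a b ^ k = lcm (a ^ k) (b ^ k) * gcd (a ^ k) (b ^ k)"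
    by (simp add: power_mult_distrib[symmetric] lcm_mult_gcd del: gcd_exp)
  with False show ?thesis
    by simp
qed

text \<open>The admissible \<open>d\<close> are bounded by a nonzero coordinate and closed under
  lcm, so the largest one is a multiple of all others. Primitivity becomes \<open>g = 1\<close>,
  which divisor sums of \<open>mobius\<close> detect.\<close>

lemma weighted_gcd_exists:
  assumes "\<And>i. i \<le> n \<Longrightarrow> q i > 0" "\<exists>i\<le>n. y i \<noteq> 0"
  obtains g where "g > 0" "\<And>d. (\<forall>i\<le>n. int d ^ q i dvd y i) \<longleftrightarrow> d dvd g"
proof -
  have iff: "int d ^ q i dvd y i \<longleftrightarrow> d ^ q i dvd nat \<bar>y i\<bar>" for d i
    by simp
  define S where "S = {d. \<forall>i\<le>n. d ^ q i dvd nat \<bar>y i\<bar>}"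
  obtain i where i: "i \<le> n" "y i \<noteq> 0"
    using assms(2) by blast
  have S0: "d > 0" if "d \<in> S" for d
    using that i assms(1)[OF i(1)] by (cases "d = 0") (auto simp: S_def power_0_left)
  have "d \<le> nat \<bar>y i\<bar>" if "d \<in> S" for d
  proof -
    have "d dvd d ^ q i"
      using assms(1)[OF i(1)] by simp
    also have "\<dots> dvd nat \<bar>y i\<bar>"
      using that i(1) unfolding S_def by blast
    finally show ?thesis
      using i by (intro dvd_imp_le) auto
  qed
  then have fin: "finite S"
    using finite_nat_set_iff_bounded_le by blast
  have one: "1 \<in> S"
    by (simp add: S_def)
  define g where "g = Max S"
  have g: "g \<in> S"
    unfolding g_def using fin one by (intro Max_in) auto
  have dvd_g: "d dvd g" if "d \<in> S" for d
  proof -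
    have "lcm d g \<in> S"
      using that g unfolding S_def mem_Collect_eq lcm_exp_nat by (blast intro: lcm_least)
    then have "lcm d g \<le> g"
      unfolding g_def using fin by (intro Max_ge)
    moreover have "g \<le> lcm d g"
      using S0[OF that] S0[OF g] by (intro dvd_imp_le) (auto intro: lcm_pos_nat)
    ultimately have "lcm d g = g"
      by simp
    then show ?thesis
      by (metis dvd_lcm1)
  qed
  have in_S: "d \<in> S" if "d dvd g" for d
    using g that unfolding S_def by (auto intro: dvd_trans dvd_power_same simp del: dvd_nat_abs_iff)
  show ?thesis
  proof (rule that)
    show "g > 0"
      by (rule S0[OF g])
    fix d
    have "(\<forall>i\<le>n. int d ^ q i dvd y i) \<longleftrightarrow> d \<in> S"
      by (simp only: iff S_def mem_Collect_eq)
    also have "d \<in> S \<longleftrightarrow> d dvd g"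
      by (rule iffI[OF dvd_g in_S])
    finally show "(\<forall>i\<le>n. int d ^ q i dvd y i) \<longleftrightarrow> d dvd g" .
  qed
qed

lemma card_nonzero_multiples:
  assumes "t > 0" "x \<ge> 0"
  shows "real (card {k::int. k \<noteq> 0 \<and> real_of_int \<bar>k\<bar> \<le> x \<and> t dvd k})
    = 2 * real_of_int \<lfloor>x / real_of_int t\<rfloor>"
proof -
  define M where "M = \<lfloor>x / real_of_int t\<rfloor>"
  have M: "M \<ge> 0"
    using assms by (simp add: M_def)
  have le_iff: "real_of_int \<bar>t * m\<bar> \<le> x \<longleftrightarrow> m \<in> {- M..M}" for m
  proof -
    have "real_of_int \<bar>t * m\<bar> \<le> x \<longleftrightarrow> real_of_int \<bar>m\<bar> \<le> x / real_of_int t"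
      using assms(1) by (simp add: abs_mult field_simps)
    then show ?thesis
      by (simp only: M_def abs_int_le_iff)
  qed
  have "{k::int. k \<noteq> 0 \<and> real_of_int \<bar>k\<bar> \<le> x \<and> t dvd k} = (*) t ` ({- M..M} - {0})"
  proof (intro equalityI subsetI)
    fix k assume k: "k \<in> {k::int. k \<noteq> 0 \<and> real_of_int \<bar>k\<bar> \<le> x \<and> t dvd k}"
    then have "t dvd k"
      by blast
    then obtain m where m: "k = t * m" ..
    with k have "m \<noteq> 0"
      by auto
    moreover have "m \<in> {- M..M}"
      using k unfolding m mem_Collect_eq le_iff by blast
    ultimately show "k \<in> (*) t ` ({- M..M} - {0})"
      using m by blast
  next
    fix k assume "k \<in> (*) t ` ({- M..M} - {0})"
    then obtain m where m: "k = t * m" "m \<in> {- M..M}" "m \<noteq> 0"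
      by blast
    have "real_of_int \<bar>k\<bar> \<le> x"
      using m(2) unfolding m(1) le_iff .
    with m assms(1) show "k \<in> {k::int. k \<noteq> 0 \<and> real_of_int \<bar>k\<bar> \<le> x \<and> t dvd k}"
      by simp
  qed
  moreover have "inj_on ((*) t) ({- M..M} - {0})"
    using assms(1) by (auto simp: inj_on_def)
  ultimately have "card {k::int. k \<noteq> 0 \<and> real_of_int \<bar>k\<bar> \<le> x \<and> t dvd k} = nat (2 * M)"
    using M by (simp add: card_image card_Diff_singleton)
  then show ?thesis
    using M by (simp add: M_def)
qed

section \<open>Moebius inversion over the weighted gcd\<close>

text \<open>For positive \<open>Y\<close>, the number of integer tuples in the box of parameter
  \<open>Y\<close> without zero coordinates, as a closed formula that can be estimated at
  \<open>X / d\<close>.\<close>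

definition full_count :: "nat \<Rightarrow> (nat \<Rightarrow> nat) \<Rightarrow> real \<Rightarrow> real" where
  "full_count n q Y = (\<Prod>i\<le>n. 2 * real_of_int \<lfloor>Y ^ q i\<rfloor>)"

text \<open>Dividing coordinate \<open>i\<close> by \<open>d ^ q i\<close> replaces the bound
  \<open>X ^ q i\<close> by \<open>(X / d) ^ q i\<close>.\<close>

lemma card_multiples_box:
  assumes "d > 0" "X > 0"
  shows "real (card {y \<in> int_box n q X. (\<forall>i\<le>n. y i \<noteq> 0) \<and> (\<forall>i\<le>n. int d ^ q i dvd y i)})
    = full_count n q (X / real d)"
proof -
  have "{y \<in> int_box n q X. (\<forall>i\<le>n. y i \<noteq> 0) \<and> (\<forall>i\<le>n. int d ^ q i dvd y i)}
    = (\<Pi>\<^sub>E i\<in>{..n}. {k. k \<noteq> 0 \<and> real_of_int \<bar>k\<bar> \<le> X ^ q i \<and> int d ^ q i dvd k})"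
    by (rule set_eqI) (simp only: int_box_def PiE_iff mem_Collect_eq Ball_def atMost_iff, metis)
  then show ?thesis
    using assms card_nonzero_multiples[of "int d ^ q i" "X ^ q i" for i]
    by (simp add: card_PiE full_count_def power_divide)
qed

text \<open>The factor at index 0 already vanishes. This makes the Moebius sum finite and settles
  the estimate for small \<open>Y\<close>.\<close>

lemma full_count_eq_0:
  assumes "0 < Y" "Y < 1" "\<And>i. i \<le> n \<Longrightarrow> q i > 0"
  shows "full_count n q Y = 0"
proof -
  have "\<lfloor>Y ^ q 0\<rfloor> = 0"
    using assms(1,2) assms(3)[of 0] by (simp add: floor_eq_iff power_Suc_less_one power_less_one_iff)
  then show ?thesis
    unfolding full_count_def by (intro prod_zero) auto
qed

text \<open>The indicator of primitivity is the sum of \<open>mobius\<close> over the divisors of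
  the weighted gcd; exchanging the sums leaves, for each \<open>d\<close>, a count of
  multiples.\<close>

lemma card_prim_box_has_sum:
  assumes q: "\<And>i. i \<le> n \<Longrightarrow> q i > 0" and X: "X > 0"
  shows "((\<lambda>d. mobius d * full_count n q (X / real d)) has_sum real (card (prim_box n q X))) {0<..}"
proof -
  define F where "F = {y \<in> int_box n q X. \<forall>i\<le>n. y i \<noteq> 0}"
  define D where "D = {d::nat. 0 < d \<and> real d \<le> X}"
  define R where "R d y \<longleftrightarrow> (\<forall>i\<le>n. int d ^ q i dvd y i)" for d y
  have finF: "finite F"
    using finite_int_box by (auto simp: F_def)
  have "D \<subseteq> {..nat \<lfloor>X\<rfloor>}"
    by (auto simp: D_def le_nat_floor)
  then have finD: "finite D"
    by (rule finite_subset) simp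
  have indicator: "(\<Sum>d\<in>{d\<in>D. R d y}. mobius d) = (if primitive n q y then 1 else 0)" if "y \<in> F" for y
  proof -
    have nz: "\<And>i. i \<le> n \<Longrightarrow> y i \<noteq> 0" and y: "y \<in> int_box n q X"
      using that by (auto simp: F_def)
    obtain g where g: "g > 0" "\<And>d. R d y \<longleftrightarrow> d dvd g"
      using weighted_gcd_exists[of n q y] q nz unfolding R_def by (metis le0)
    \<comment> \<open>Coordinate 0 is nonzero and at most \<open>X ^ q 0\<close> in size, so every
      divisor \<open>d\<close> of the weighted gcd is at most \<open>X\<close>; one finite range
      serves all tuples.\<close>
    have "d \<in> D" if "R d y" for d
    proof -
      have "int d ^ q 0 dvd y 0"
        using that by (simp add: R_def)
      then have "int d ^ q 0 \<le> \<bar>y 0\<bar>"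
        using nz[of 0] dvd_imp_le_int[of "y 0" "int d ^ q 0"] by simp
      then have "real d ^ q 0 \<le> real_of_int \<bar>y 0\<bar>"
        by (metis of_int_le_iff of_int_of_nat_eq of_int_power)
      also have "\<dots> \<le> X ^ q 0"
        using y by (auto simp: int_box_def PiE_iff)
      finally have "real d \<le> X"
        using X q[of 0] by simp
      moreover have "d > 0"
        using that g by (auto intro!: Nat.gr0I)
      ultimately show ?thesis
        by (simp add: D_def)
    qed
    then have "{d\<in>D. R d y} = {d. d dvd g}"
      using g(2) by auto
    moreover have "primitive n q y \<longleftrightarrow> g = 1"
      unfolding primitive_def R_def[symmetric] g(2) by (metis dvd_refl nat_dvd_1_iff_1)
    ultimately show ?thesis
      using sum_mobius_divisors[OF g(1)] by simp
  qed
  have "real (card (prim_box n q X)) = (\<Sum>y\<in>F. if primitive n q y then 1 else 0)"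
    using finF by (simp add: prim_box_def F_def sum.If_cases Int_def conj_assoc)
  also have "\<dots> = (\<Sum>y\<in>F. \<Sum>d\<in>{d\<in>D. R d y}. mobius d)"
    by (intro sum.cong) (auto simp: indicator)
  also have "\<dots> = (\<Sum>d\<in>D. \<Sum>y\<in>{y\<in>F. R d y}. mobius d)"
    by (rule sum.swap_restrict[OF finF finD])
  also have "\<dots> = (\<Sum>d\<in>D. mobius d * full_count n q (X / real d))"
  proof (rule sum.cong)
    fix d assume "d \<in> D"
    then have "real (card {y\<in>F. R d y}) = full_count n q (X / real d)"
      using card_multiples_box[of d X n q] X by (simp add: D_def F_def R_def conj_assoc)
    then show "(\<Sum>y\<in>{y\<in>F. R d y}. mobius d) = mobius d * full_count n q (X / real d)"
      by simp
  qed simp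
  finally have "real (card (prim_box n q X)) = (\<Sum>d\<in>D. mobius d * full_count n q (X / real d))" .
  \<comment> \<open>Terms with \<open>d > X\<close> vanish, so the finite sum extends to all
    positive \<open>d\<close>.\<close>
  moreover have "full_count n q (X / real d) = 0" if "d \<in> {0<..} - D" for d
    using that X q by (intro full_count_eq_0) (auto simp: D_def)
  ultimately show ?thesis
    using finD by (intro has_sum_finite_neutralI[of D]) (auto simp: D_def)
qed

section \<open>Asymptotics of the number of primitive tuples\<close>

text \<open>Weierstrass product inequality: the remaining product is at most 1, so a new factor
  lowers it by at most \<open>t a\<close>.\<close>

lemma one_minus_sum_le_prod:
  fixes t :: "'a \<Rightarrow> real"
  assumes "finite A" "\<And>i. i \<in> A \<Longrightarrow> 0 \<le> t i \<and> t i \<le> 1"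
  shows "1 - (\<Sum>i\<in>A. t i) \<le> (\<Prod>i\<in>A. 1 - t i)"
  using assms
proof (induction A rule: finite_induct)
  case (insert a A)
  have "(\<Prod>i\<in>A. 1 - t i) \<le> 1"
    using insert by (intro prod_le_1) auto
  then have "t a * (\<Prod>i\<in>A. 1 - t i) \<le> t a"
    using insert.prems[of a] by (intro mult_left_le) auto
  then show ?case
    using insert by (simp add: algebra_simps)
qed simp

text \<open>For \<open>Y < 1\<close> the count is 0 and the main term is itself below the error
  term, since the smaller exponent gives the larger power. For \<open>Y\<close> \<ge> 1 each floor
  loses at most 1, a relative loss of \<open>1 / Y ^ q i\<close>, and the losses add up by
  \<open>one_minus_sum_le_prod\<close>.\<close>

lemma full_count_approx:
  assumes q: "\<And>i. i \<le> n \<Longrightarrow> q i > 0" and m: "m = Min (q ` {..n})" and Q: "Q = (\<Sum>i\<le>n. q i)"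
    and Y: "Y > 0"
  shows "\<bar>full_count n q Y - 2 ^ (n + 1) * Y ^ Q\<bar> \<le> 2 ^ (n + 1) * real (n + 1) * Y ^ (Q - m)"
proof (cases "Y < 1")
  case True
  have "Y ^ Q \<le> Y ^ (Q - m)"
    using True Y by (intro power_decreasing) auto
  also have "\<dots> \<le> real (n + 1) * Y ^ (Q - m)"
    using Y by (simp add: mult_le_cancel_right1)
  finally show ?thesis
    using full_count_eq_0[OF Y True q] Y by (simp add: mult.assoc)
next
  case False
  then have Y1: "Y \<ge> 1"
    by simp
  have mi: "m \<le> q i" if "i \<le> n" for i
    unfolding m using that by (intro Min_le) auto
  have "m \<le> Q"
    using mi[of 0] member_le_sum[of 0 "{..n}" q] by (simp add: Q)
  have full: "full_count n q Y = 2 ^ (n + 1) * (\<Prod>i\<le>n. real_of_int \<lfloor>Y ^ q i\<rfloor>)"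
    unfolding full_count_def prod.distrib by simp
  have prodY: "(\<Prod>i\<le>n. Y ^ q i) = Y ^ Q"
    by (simp add: Q power_sum)
  have upper: "(\<Prod>i\<le>n. real_of_int \<lfloor>Y ^ q i\<rfloor>) \<le> Y ^ Q"
    unfolding prodY[symmetric] using Y by (intro prod_mono) auto
  have "Y ^ Q * (1 - (\<Sum>i\<le>n. 1 / Y ^ q i)) \<le> Y ^ Q * (\<Prod>i\<le>n. 1 - 1 / Y ^ q i)"
    using Y Y1 by (intro mult_left_mono one_minus_sum_le_prod) auto
  also have "\<dots> = (\<Prod>i\<le>n. Y ^ q i * (1 - 1 / Y ^ q i))"
    unfolding prodY[symmetric] prod.distrib ..
  also have "\<dots> \<le> (\<Prod>i\<le>n. real_of_int \<lfloor>Y ^ q i\<rfloor>)"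
  proof (rule prod_mono)
    fix i
    have "Y ^ q i * (1 - 1 / Y ^ q i) = Y ^ q i - 1"
      using Y by (simp add: field_simps)
    moreover have "Y ^ q i \<ge> 1"
      using Y1 by simp
    ultimately show "0 \<le> Y ^ q i * (1 - 1 / Y ^ q i) \<and> Y ^ q i * (1 - 1 / Y ^ q i) \<le> real_of_int \<lfloor>Y ^ q i\<rfloor>"
      by linarith
  qed
  finally have "Y ^ Q - (\<Prod>i\<le>n. real_of_int \<lfloor>Y ^ q i\<rfloor>) \<le> Y ^ Q * (\<Sum>i\<le>n. 1 / Y ^ q i)"
    by (simp add: algebra_simps)
  \<comment> \<open>The least weight dominates every relative loss, which produces the exponent
    \<open>Q - m\<close>.\<close>
  also have "(\<Sum>i\<le>n. 1 / Y ^ q i) \<le> (\<Sum>i\<le>n. 1 / Y ^ m)"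
    using Y Y1 mi by (intro sum_mono divide_left_mono power_increasing) auto
  also have "Y ^ Q * (\<Sum>i\<le>n. 1 / Y ^ m) = real (n + 1) * Y ^ (Q - m)"
    using Y \<open>m \<le> Q\<close> by (simp add: power_diff)
  finally have "\<bar>(\<Prod>i\<le>n. real_of_int \<lfloor>Y ^ q i\<rfloor>) - Y ^ Q\<bar> \<le> real (n + 1) * Y ^ (Q - m)"
    using upper Y by (simp add: mult_left_mono)
  then have "2 ^ (n + 1) * \<bar>(\<Prod>i\<le>n. real_of_int \<lfloor>Y ^ q i\<rfloor>) - Y ^ Q\<bar>
    \<le> 2 ^ (n + 1) * (real (n + 1) * Y ^ (Q - m))"
    by (intro mult_left_mono) auto
  moreover have "2 ^ (n + 1) * \<bar>(\<Prod>i\<le>n. real_of_int \<lfloor>Y ^ q i\<rfloor>) - Y ^ Q\<bar>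
    = \<bar>full_count n q Y - 2 ^ (n + 1) * Y ^ Q\<bar>"
    unfolding full by (simp add: abs_mult flip: right_diff_distrib)
  ultimately show ?thesis
    by (simp only: mult.assoc)
qed

text \<open>Inserting \<open>full_count_approx\<close> into the Moebius sum, the main terms add up
  to \<open>1 / zeta Q\<close> and the errors to at most \<open>zeta (Q - m)\<close>, up to
  constants and powers of \<open>X\<close>; the latter series converges as \<open>Q - m\<close>
  \<ge> 2.\<close>

lemma card_prim_box_approx:
  assumes q: "\<And>i. i \<le> n \<Longrightarrow> q i > 0" and m: "m = Min (q ` {..n})" and Q: "Q = (\<Sum>i\<le>n. q i)"
    and Qm: "Q - m \<ge> 2" and X: "X > 0"
  shows "\<bar>real (card (prim_box n q X)) - 2 ^ (n + 1) / zeta (real Q) * X ^ Q\<bar>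
    \<le> 2 ^ (n + 1) * real (n + 1) * zeta (real (Q - m)) * X ^ (Q - m)"
proof -
  define K :: real where "K = 2 ^ (n + 1) * real (n + 1)"
  have "((\<lambda>d. 2 ^ (n + 1) * X ^ Q * (mobius d / real d ^ Q)) has_sum
      2 ^ (n + 1) * X ^ Q * (1 / zeta (real Q))) {0<..}"
    using Qm by (intro has_sum_cmult_right mobius_has_sum) auto
  from has_sum_add[OF card_prim_box_has_sum[OF q X] has_sum_uminusI[OF this]]
  have diff: "((\<lambda>d. mobius d * full_count n q (X / real d) - 2 ^ (n + 1) * X ^ Q * (mobius d / real d ^ Q))
    has_sum real (card (prim_box n q X)) - 2 ^ (n + 1) * X ^ Q * (1 / zeta (real Q))) {0<..}"
    by simp
  have bound: "((\<lambda>d. K * X ^ (Q - m) * (1 / real d ^ (Q - m))) has_sum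
    K * X ^ (Q - m) * zeta (real (Q - m))) {0<..}"
    by (intro has_sum_cmult_right zeta_has_sum Qm)
  have "norm (real (card (prim_box n q X)) - 2 ^ (n + 1) * X ^ Q * (1 / zeta (real Q)))
    \<le> K * X ^ (Q - m) * zeta (real (Q - m))"
  proof (rule norm_infsum_le[OF diff bound])
    fix d :: nat assume "d \<in> {0<..}"
    then have Y: "X / real d > 0"
      using X by simp
    have "mobius d * full_count n q (X / real d) - 2 ^ (n + 1) * X ^ Q * (mobius d / real d ^ Q)
      = mobius d * (full_count n q (X / real d) - 2 ^ (n + 1) * (X / real d) ^ Q)"
      by (simp add: power_divide algebra_simps)
    also have "norm \<dots> \<le> 1 * \<bar>full_count n q (X / real d) - 2 ^ (n + 1) * (X / real d) ^ Q\<bar>"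
      unfolding real_norm_def abs_mult by (intro mult_right_mono abs_mobius_le) auto
    also have "\<dots> \<le> K * (X / real d) ^ (Q - m)"
      using full_count_approx[OF q m Q Y] by (simp add: K_def)
    finally show "norm (mobius d * full_count n q (X / real d) - 2 ^ (n + 1) * X ^ Q * (mobius d / real d ^ Q))
      \<le> K * X ^ (Q - m) * (1 / real d ^ (Q - m))"
      by (simp add: power_divide)
  qed
  then show ?thesis
    by (simp add: K_def mult_ac)
qed

section \<open>Tuples with a zero coordinate\<close>

text \<open>Fixing coordinate \<open>j\<close> at 0 loses a factor \<open>X ^ q j\<close>, at least
  \<open>X ^ m\<close>; every other coordinate has at most \<open>2 * X ^ q i + 1\<close> values,
  hence at most \<open>3 * X ^ q i\<close> because \<open>X\<close> \<ge> 1.\<close>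

lemma card_zero_box_le:
  assumes m: "m = Min (q ` {..n})" and Q: "Q = (\<Sum>i\<le>n. q i)" and X: "X \<ge> 1"
  shows "real (card (zero_box n q X)) \<le> real (n + 1) * 3 ^ (n + 1) * X ^ (Q - m)"
proof -
  define B where "B j = (\<Pi>\<^sub>E i\<in>{..n}. if i = j then {0} else {k. real_of_int \<bar>k\<bar> \<le> X ^ q i})" for j
  have "zero_box n q X \<subseteq> (\<Union>j\<in>{..n}. B j)"
  proof
    fix y assume "y \<in> zero_box n q X"
    then obtain j where "y \<in> int_box n q X" "j \<le> n" "y j = 0"
      by (auto simp: zero_box_def)
    then have "y \<in> B j"
      by (auto simp: B_def int_box_def PiE_iff)
    with \<open>j \<le> n\<close> show "y \<in> (\<Union>j\<in>{..n}. B j)"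
      by blast
  qed
  moreover have "finite (B j)" for j
    unfolding B_def abs_int_le_iff by (intro finite_PiE) auto
  ultimately have "card (zero_box n q X) \<le> card (\<Union>j\<in>{..n}. B j)"
    by (intro card_mono) auto
  also have "\<dots> \<le> (\<Sum>j\<le>n. card (B j))"
    by (rule card_UN_le) simp
  finally have "real (card (zero_box n q X)) \<le> (\<Sum>j\<le>n. real (card (B j)))"
    by (simp flip: of_nat_sum)
  also have "\<dots> \<le> (\<Sum>j\<le>n. 3 ^ (n + 1) * X ^ (Q - m))"
  proof (rule sum_mono)
    fix j assume "j \<in> {..n}"
    then have j: "j \<le> n"
      by simp
    have "real (card (B j)) = (\<Prod>i\<le>n. real (card (if i = j then {0::int} else {k. real_of_int \<bar>k\<bar> \<le> X ^ q i})))"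
      unfolding B_def by (simp add: card_PiE)
    \<comment> \<open>The single value at \<open>j\<close> is also bounded by 3, which gives all
      factors the same shape.\<close>
    also have "\<dots> \<le> (\<Prod>i\<le>n. 3 * X ^ (if i = j then 0 else q i))"
    proof (rule prod_mono, intro conjI)
      fix i
      have "X ^ q i \<ge> 1"
        using X by simp
      then have "real (nat (1 + \<lfloor>X ^ q i\<rfloor> * 2)) \<le> 3 * X ^ q i"
        by linarith
      moreover have "card {k. real_of_int \<bar>k\<bar> \<le> X ^ q i} = nat (1 + \<lfloor>X ^ q i\<rfloor> * 2)"
        unfolding abs_int_le_iff Collect_mem_eq by (simp add: algebra_simps)
      ultimately have "real (card {k. real_of_int \<bar>k\<bar> \<le> X ^ q i}) \<le> 3 * X ^ q i"
        by (simp only:)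
      then show "real (card (if i = j then {0::int} else {k. real_of_int \<bar>k\<bar> \<le> X ^ q i}))
        \<le> 3 * X ^ (if i = j then 0 else q i)"
        by (simp del: of_int_abs)
    qed simp
    also have "\<dots> = 3 ^ (n + 1) * X ^ (\<Sum>i\<le>n. if i = j then 0 else q i)"
      unfolding prod.distrib by (simp add: power_sum)
    also have "(\<Sum>i\<le>n. if i = j then 0 else q i) = Q - q j"
    proof -
      have "(\<Sum>i\<le>n. if i = j then 0 else q i) = (\<Sum>i\<in>{..n} - {j}. q i)"
        by (intro sum.mono_neutral_cong_right) auto
      also have "\<dots> = Q - q j"
        using j by (simp add: Q sum_diff1_nat)
      finally show ?thesis .
    qed
    also have "X ^ (Q - q j) \<le> X ^ (Q - m)"
      using X j by (intro power_increasing diff_le_mono2) (auto simp: m)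
    finally show "real (card (B j)) \<le> 3 ^ (n + 1) * X ^ (Q - m)"
      by simp
  qed
  finally show ?thesis
    by simp
qed

section \<open>Counting points of bounded tautological height\<close>

theorem theorem1:
  fixes n :: nat and q :: "nat \<Rightarrow> nat" and h :: "(nat \<Rightarrow> complex) set \<Rightarrow> real" and Q :: nat
  assumes "n \<ge> 1"
    and "\<And>i. i \<le> n \<Longrightarrow> q i > 0"
    and "Gcd (q ` {..n}) = 1"
    and "\<not> (n = 1 \<and> q 0 = 1 \<and> q 1 = 1)"
    and "tautological_height n q h"
    and "Q = (\<Sum>i\<le>n. q i)"
  shows "(\<lambda>X::real. real (Z_count n q h X) - 2 ^ n / zeta (real Q) * X ^ Q)
           \<in> O[at_top](\<lambda>X. X ^ (Q - Min (q ` {..n})))"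
proof -
  define m where "m = Min (q ` {..n})"
  have "m \<in> q ` {..n}"
    unfolding m_def by (intro Min_in) auto
  then obtain j where j: "j \<le> n" "m = q j"
    by auto
  have Qj: "Q - m = (\<Sum>i\<in>{..n} - {j}. q i)"
    using j by (simp add: assms(6) sum.remove[of "{..n}" j])
  \<comment> \<open>\<open>Q - m\<close> is the sum of the \<open>n\<close> weights other than one
    minimal weight. Two or more positive weights suffice; for \<open>n = 1\<close> the remaining
    weight is the larger one, which is 1 only for weights (1, 1).\<close>
  have Qm: "Q - m \<ge> 2"
  proof (cases "n = 1")
    case True
    have "m \<le> q 0" "m \<le> q 1"
      unfolding m_def using True by (auto intro!: Min_le)
    moreover have "Q = q 0 + q 1"
      using True assms(6) by simp
    ultimately show ?thesis
      using assms(2)[of 0] assms(2)[of 1] assms(4) True j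
      by (cases "j = 0") (auto simp: le_Suc_eq)
  next
    case False
    then have "2 \<le> (\<Sum>i\<in>{..n} - {j}. 1::nat)"
      using assms(1) j by simp
    also have "\<dots> \<le> Q - m"
      unfolding Qj using assms(2) by (intro sum_mono) (auto simp: Suc_le_eq)
    finally show ?thesis .
  qed
  \<comment> \<open>The error constant for the doubled count: the error for primitive tuples plus
    twice the bound for tuples with a zero coordinate.\<close>
  define K where "K = 2 ^ (n + 1) * real (n + 1) * zeta (real (Q - m))
    + 2 * (real (n + 1) * 3 ^ (n + 1))"
  have "\<bar>real (Z_count n q h X) - 2 ^ n / zeta (real Q) * X ^ Q\<bar> \<le> K * X ^ (Q - m)" if "X \<ge> 1" for X
  proof -
    have X: "X > 0"
      using that by simp
    note Z = Z_count_bounds[OF assms(2,3,5) X]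
    have "real (card (prim_box n q X)) \<le> 2 * real (Z_count n q h X)"
      "2 * real (Z_count n q h X) \<le> real (card (prim_box n q X)) + 2 * real (card (zero_box n q X))"
      using Z by linarith+
    moreover note card_prim_box_approx[OF assms(2) m_def assms(6) Qm X]
      card_zero_box_le[OF m_def assms(6) that]
    ultimately have "\<bar>2 * real (Z_count n q h X) - 2 ^ (n + 1) / zeta (real Q) * X ^ Q\<bar> \<le> K * X ^ (Q - m)"
      unfolding K_def distrib_right by linarith
    then show ?thesis
      by (simp add: abs_le_iff)
  qed
  then have "eventually (\<lambda>X. norm (real (Z_count n q h X) - 2 ^ n / zeta (real Q) * X ^ Q)
    \<le> K * norm (X ^ (Q - m))) at_top"
    by (intro eventually_at_top_linorderI[of 1]) auto
  then show ?thesis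
    unfolding m_def[symmetric] by (rule bigoI)
qed

end
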